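(* Let $\rho\in\mathcal P^-$ with $\|\rho\|<1$ and let $\delta>0$ be such that $(1+\delta)\rho\in\mathcal P^-$ and $\overline C((1+\delta)\rho)<+\infty$. Then there exists a Lipschitz continuous $u\in\mathcal A$ that is optimal in the dual problem, i.e. $$\overline C(\rho)=\int u\,d\rho+(1-\|\rho\|)u_\infty=\sup_{\psi\in\mathcal A}\left\{\int\psi\,d\rho+(1-\|\rho\|)\psi_\infty\right\}.$$ The Lipschitz constant of $u$ depends only on $\delta$. Furthermore, any $v\in\mathcal A$ attaining this supremum coincides on the support of $\rho$ with a Lipschitz continuous element of $\mathcal A$ attaining this supremum.
   Context: Let $d\ge1$ and $N\ge 2$ be fixed integers. $\mathcal P$ is the set of Borel probability measures on $\mathbb R^d$; $\mathcal P^-$ is the set of nonnegative Borel measures $\rho$ on $\mathbb R^d$ with total mass $\|\rho\|=\rho(\mathbb R^d)\le 1$. $\rho_n\stackrel{*}{\rightharpoonup}\rho$ denotes weak* convergence in duality with $C_0$, the continuous functions on $\mathbb R^d$ vanishing at infinity. Let $c(x_1,\dots,x_N)=\sum_{1\le i<j\le N}\frac1{|x_i-x_j|}$ for $x_i\in\mathbb R^d$ (with $1/0=+\infty$). For $\rho\in\mathcal P$, $C(\rho)=\inf\{\int c\,dP : P \text{ Borel probability on }(\mathbb R^d)^N \text{ with all } N \text{ marginals equal to } \rho\}$. For $\rho\in\mathcal P^-$, $\overline C(\rho)=\inf\{\liminf_n C(\rho_n) : \rho_n\in\mathcal P,\ \rho_n\stackrel{*}{\rightharpoonup}\rho\}$.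 $C_0\oplus\mathbb R$ is the set of functions $\varphi+\kappa$ with $\varphi\in C_0$, $\kappa\in\mathbb R$; for such a function $\psi$, $\psi_\infty=\lim_{|x|\to\infty}\psi(x)$. $\mathcal A$ is the set of $\psi\in C_0\oplus\mathbb R$ such that $\frac1N\sum_{i=1}^N\psi(x_i)\le c(x_1,\dots,x_N)$ for all $(x_1,\dots,x_N)\in(\mathbb R^d)^N$.
   Formalization: The Lipschitz constant of u is shown to depend only on δ and the finite value C̄((1+δ)ρ) (with N, d fixed), not on δ alone: rescaling ρ by x ↦ x/t keeps δ but multiplies Lipschitz constants by t², so a constant uniform in ρ is impossible. *)

theory Defs
  imports "HOL-Probability.Probability"
begin

definition borel_probs :: "'a::topological_space measure set" where
  "borel_probs = {\<rho>. prob_space \<rho> \<and> sets \<rho> = sets borel}"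

definition borel_subprobs :: "'a::topological_space measure set" where
  "borel_subprobs = {\<rho>. sets \<rho> = sets borel \<and> emeasure \<rho> UNIV \<le> 1}"

definition mass :: "'a measure \<Rightarrow> real" where
  "mass \<rho> = measure \<rho> UNIV"

definition msupport :: "'a::topological_space measure \<Rightarrow> 'a set" where
  "msupport \<rho> = {x. \<forall>U. open U \<and> x \<in> U \<longrightarrow> emeasure \<rho> U > 0}"

definition C0 :: "('a::real_normed_vector \<Rightarrow> real) set" where
  "C0 = {\<phi>. continuous_on UNIV \<phi> \<and> (\<phi> \<longlongrightarrow> 0) at_infinity}"

definition C0_plus_const :: "('a::real_normed_vector \<Rightarrow> real) set" where
  "C0_plus_const = {\<psi>. \<exists>\<phi>\<in>C0. \<exists>\<kappa>. \<psi> = (\<lambda>x. \<phi> x + \<kappa>)}"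

definition value_at_infinity :: "('a::real_normed_vector \<Rightarrow> real) \<Rightarrow> real" where
  "value_at_infinity \<psi> = Lim at_infinity \<psi>"

definition weak_star_conv ::
    "(nat \<Rightarrow> 'a::real_normed_vector measure) \<Rightarrow> 'a measure \<Rightarrow> bool" where
  "weak_star_conv \<rho>n \<rho> \<longleftrightarrow>
     (\<forall>\<phi>\<in>C0. (\<lambda>n. \<integral>x. \<phi> x \<partial>\<rho>n n) \<longlonglongrightarrow> (\<integral>x. \<phi> x \<partial>\<rho>))"

(* A point (x_1, ..., x_N) is a function on nat of which only the values on {1..N} matter.
   Coinciding points give infinite cost: 1 / 0 = top in ennreal. *)
definition coulomb_cost :: "nat \<Rightarrow> (nat \<Rightarrow> 'a::real_normed_vector) \<Rightarrow> ennreal" where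
  "coulomb_cost N x = (\<Sum>i\<in>{1..N}. \<Sum>j\<in>{i<..N}. 1 / ennreal (norm (x i - x j)))"

(* On a second countable space the product sigma-algebra used here is the Borel
   sigma-algebra of the N-fold product. *)
definition transport_plans ::
    "nat \<Rightarrow> 'a::topological_space measure \<Rightarrow> (nat \<Rightarrow> 'a) measure set" where
  "transport_plans N \<rho> =
     {P. prob_space P \<and> sets P = sets (Pi\<^sub>M {1..N} (\<lambda>_. borel)) \<and>
         (\<forall>i\<in>{1..N}. distr P borel (\<lambda>x. x i) = \<rho>)}"

definition transport_cost :: "nat \<Rightarrow> 'a::euclidean_space measure \<Rightarrow> ennreal" where
  "transport_cost N \<rho> = (INF P\<in>transport_plans N \<rho>. \<integral>\<^sup>+ x. coulomb_cost N x \<partial>P)"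

definition relaxed_cost :: "nat \<Rightarrow> 'a::euclidean_space measure \<Rightarrow> ennreal" where
  "relaxed_cost N \<rho> =
     Inf {liminf (\<lambda>n. transport_cost N (\<rho>n n)) | \<rho>n.
            (\<forall>n. \<rho>n n \<in> borel_probs) \<and> weak_star_conv \<rho>n \<rho>}"

definition admissible :: "nat \<Rightarrow> ('a::euclidean_space \<Rightarrow> real) set" where
  "admissible N =
     {\<psi>\<in>C0_plus_const. \<forall>x :: nat \<Rightarrow> 'a.
        ereal (1 / real N * (\<Sum>i\<in>{1..N}. \<psi> (x i))) \<le> enn2ereal (coulomb_cost N x)}"

definition dual_value :: "'a::euclidean_space measure \<Rightarrow> ('a \<Rightarrow> real) \<Rightarrow> real" where
  "dual_value \<rho> \<psi> = (\<integral>x. \<psi> x \<partial>\<rho>) + (1 - mass \<rho>) * value_at_infinity \<psi>"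

definition dual_sup :: "nat \<Rightarrow> 'a::euclidean_space measure \<Rightarrow> ereal" where
  "dual_sup N \<rho> = (SUP \<psi>\<in>admissible N. ereal (dual_value \<rho> \<psi>))"

end

theory Submission
  imports Defs "HOL-Real_Asymp.Real_Asymp" "HOL-Complex_Analysis.Great_Picard"
begin

text \<open>
  Strong duality is obtained by penalization: over finitely supported plans one nearly minimizes the
  cost plus \<open>n\<close> times the squared errors of the first \<open>n\<close> moments with respect to a countable family
  of test functions determining weak* convergence. The first-order condition in the direction of a
  Dirac mass says precisely that an explicit combination of the test functions is admissible, with
  dual value almost equal to the penalized cost, and the marginals of the minimizers converge to
  \<open>\<rho>\<close>.

  For attainment, pass to the one-point compactification, encoded as \<open>'a option\<close> with \<open>None\<close> for the
  point at infinity. Testing the dual problem at \<open>(1 + \<delta>) \<rho>\<close> bounds \<open>\<psi>\<^sub>\<infinity>\<close> from below, hence \<open>\<psi>\<close> from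
  above, for every almost optimal \<open>\<psi>\<close>; the singular cost may then be replaced by a truncated, Lipschitz
  one. Averaging \<open>\<psi>\<close> with its \<open>c\<close>-transform increases \<open>\<psi>\<close>, and the limit of the iterates is a fixed point
  of the transform, hence Lipschitz with a uniform constant and continuous at infinity. Pointwise
  limits of such potentials stay feasible for the truncated cost, and regularizing the limit once more
  restores continuity at infinity. Regularizing an arbitrary maximizer \<open>v\<close> can only increase it, so it
  does not change \<open>\<rho>\<close>-almost everywhere.
\<close>

section \<open>Truncated cost and its transform\<close>

text \<open>The value at \<open>None\<close> is the limit of \<open>1 / max r (norm (x - y))\<close>
  as one argument escapes to infinity. For r > 0 the kernel is bounded, Lipschitz in finite
  arguments, and continuous up to infinity in each of them.\<close>

definition trunc_kernel :: "real \<Rightarrow> 'a::real_normed_vector option \<Rightarrow> 'a option \<Rightarrow> real" where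
  "trunc_kernel r a b =
     (case a of None \<Rightarrow> 0 | Some x \<Rightarrow> (case b of None \<Rightarrow> 0 | Some y \<Rightarrow> 1 / max r (norm (x - y))))"

definition trunc_cost :: "nat \<Rightarrow> real \<Rightarrow> (nat \<Rightarrow> 'a::real_normed_vector option) \<Rightarrow> real" where
  "trunc_cost N r x = (\<Sum>i\<in>{1..N}. \<Sum>j\<in>{i<..N}. trunc_kernel r (x i) (x j))"

text \<open>The dual constraint for the truncated cost, multiplied by N. No continuity is asked for,
  so the condition is stable under pointwise limits.\<close>

definition feasible :: "nat \<Rightarrow> real \<Rightarrow> ('a::real_normed_vector option \<Rightarrow> real) \<Rightarrow> bool" where
  "feasible N r \<psi> \<longleftrightarrow> (\<forall>x. (\<Sum>i\<in>{1..N}. \<psi> (x i)) \<le> real N * trunc_cost N r x)"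

text \<open>A c-transform. The slot \<open>k\<close> that receives \<open>y\<close> belongs to the
  infimum, so the resulting bound can be used in every slot without an appeal to the symmetry of
  \<open>trunc_cost\<close>.\<close>

definition ctrans ::
    "nat \<Rightarrow> real \<Rightarrow> ('a::real_normed_vector option \<Rightarrow> real) \<Rightarrow> 'a option \<Rightarrow> real" where
  "ctrans N r \<psi> y =
     (INF (k, x)\<in>{1..N} \<times> UNIV.
        real N * trunc_cost N r (x(k := y)) - (\<Sum>i\<in>{1..N} - {k}. \<psi> (x i)))"

section \<open>Estimates for the truncated kernel and cost\<close>

lemma trunc_kernel_simps [simp]:
  "trunc_kernel r None b = 0"
  "trunc_kernel r a None = 0"
  "trunc_kernel r (Some x) (Some y) = 1 / max r (norm (x - y))"
  by (auto simp: trunc_kernel_def split: option.splits)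

lemma trunc_kernel_commute: "trunc_kernel r a b = trunc_kernel r b a"
  by (cases a; cases b) (auto simp: norm_minus_commute)

lemma trunc_kernel_nonneg: "r > 0 \<Longrightarrow> 0 \<le> trunc_kernel r a b"
  by (cases a; cases b) auto

text \<open>Taking the maximum with r is 1-Lipschitz, and
  \<open>1 / s - 1 / t = (t - s) / (s * t)\<close> with s and t at least r.\<close>

lemma trunc_kernel_lipschitz:
  assumes r: "r > 0"
  shows "\<bar>trunc_kernel r (Some y) b - trunc_kernel r (Some z) b\<bar> \<le> norm (y - z) / r\<^sup>2"
proof (cases b)
  case None
  then show ?thesis using r by simp
next
  case (Some w)
  define s t where "s = max r (norm (y - w))" and "t = max r (norm (z - w))"
  have st: "s \<ge> r" "t \<ge> r" by (auto simp: s_def t_def)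
  have "\<bar>norm (y - w) - norm (z - w)\<bar> \<le> norm (y - z)"
    using norm_triangle_ineq3[of "y - w" "z - w"] by simp
  then have d: "\<bar>t - s\<bar> \<le> norm (y - z)" by (auto simp: s_def t_def)
  have "1 / s - 1 / t = (t - s) / (s * t)" using st r by (auto simp: field_simps)
  then have "\<bar>1 / s - 1 / t\<bar> = \<bar>t - s\<bar> / (s * t)" using st r by (simp add: abs_mult)
  also have "\<dots> \<le> norm (y - z) / (r * r)"
    using st r d by (intro frac_le mult_mono) auto
  finally show ?thesis by (simp add: Some s_def t_def power2_eq_square)
qed

lemma trunc_kernel_tendsto_0:
  assumes r: "r > 0"
  shows "((\<lambda>y. trunc_kernel r (Some y) b) \<longlongrightarrow> 0) at_infinity"
proof (cases b)
  case None
  then show ?thesis by simp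
next
  case (Some w)
  have "filterlim (\<lambda>y. norm (y + (- w))) at_top at_infinity"
    by (intro filterlim_at_infinity_imp_norm_at_top
        tendsto_add_filterlim_at_infinity'[OF filterlim_ident tendsto_const])
  then have "filterlim (\<lambda>y. max r (norm (y - w))) at_top at_infinity"
    by (rule filterlim_at_top_mono) (auto intro!: always_eventually)
  then have "filterlim (\<lambda>y. max r (norm (y - w))) at_infinity at_infinity"
    by (rule filterlim_at_top_imp_at_infinity)
  then have "((\<lambda>y. 1 / max r (norm (y - w))) \<longlongrightarrow> 0) at_infinity"
    by (intro tendsto_divide_0[OF tendsto_const])
  then show ?thesis by (simp add: Some)
qed

lemma trunc_cost_nonneg: "r > 0 \<Longrightarrow> 0 \<le> trunc_cost N r x"
  unfolding trunc_cost_def by (intro sum_nonneg trunc_kernel_nonneg)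

text \<open>Sending an argument to infinity only removes nonnegative interactions. This gives one
  half of the continuity of the transform at infinity.\<close>

lemma trunc_cost_None_le:
  assumes r: "r > 0"
  shows "trunc_cost N r (x(k := None)) \<le> trunc_cost N r (x(k := y))"
  unfolding trunc_cost_def
  by (intro sum_mono) (auto simp: trunc_kernel_nonneg[OF r])

lemma trunc_cost_tendsto_None:
  assumes r: "r > 0"
  shows "((\<lambda>y. trunc_cost N r (x(k := Some y))) \<longlongrightarrow> trunc_cost N r (x(k := None))) at_infinity"
proof -
  have "((\<lambda>y. trunc_kernel r ((x(k := Some y)) i) ((x(k := Some y)) j)) \<longlongrightarrow>
          trunc_kernel r ((x(k := None)) i) ((x(k := None)) j)) at_infinity" if "i < j" for i j
  proof -
    consider "i = k" "j \<noteq> k" | "i \<noteq> k" "j = k" | "i \<noteq> k" "j \<noteq> k" using \<open>i < j\<close> by auto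
    then show ?thesis
    proof cases
      case 1
      then show ?thesis using trunc_kernel_tendsto_0[OF r] by simp
    next
      case 2
      then show ?thesis
        using trunc_kernel_tendsto_0[OF r, of "x i"]
        by (simp add: trunc_kernel_commute[of r "x i"])
    qed simp
  qed
  then show ?thesis unfolding trunc_cost_def by (intro tendsto_sum) auto
qed

text \<open>Each of the at most N * N pairs is charged the kernel estimate, which is crude but
  independent of the other arguments.\<close>

lemma trunc_cost_lipschitz:
  assumes r: "r > 0"
  shows "\<bar>trunc_cost N r (x(k := Some y)) - trunc_cost N r (x(k := Some z))\<bar>
           \<le> (real N)\<^sup>2 / r\<^sup>2 * norm (y - z)"
proof -
  let ?d = "\<lambda>i j. trunc_kernel r ((x(k := Some y)) i) ((x(k := Some y)) j)
                  - trunc_kernel r ((x(k := Some z)) i) ((x(k := Some z)) j)"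
  have d: "\<bar>?d i j\<bar> \<le> norm (y - z) / r\<^sup>2" if "i < j" for i j
  proof -
    consider "i = k" "j \<noteq> k" | "i \<noteq> k" "j = k" | "i \<noteq> k" "j \<noteq> k" using \<open>i < j\<close> by auto
    then show ?thesis
    proof cases
      case 1
      then show ?thesis using trunc_kernel_lipschitz[OF r] by simp
    next
      case 2
      then show ?thesis
        using trunc_kernel_lipschitz[OF r, of y "x i" z]
        by (simp add: trunc_kernel_commute[of r "x i"])
    qed simp
  qed
  have "\<bar>trunc_cost N r (x(k := Some y)) - trunc_cost N r (x(k := Some z))\<bar>
        = \<bar>\<Sum>i\<in>{1..N}. \<Sum>j\<in>{i<..N}. ?d i j\<bar>"
    unfolding trunc_cost_def by (simp only: sum_subtractf)
  also have "\<dots> \<le> (\<Sum>i\<in>{1..N}. \<Sum>j\<in>{i<..N}. \<bar>?d i j\<bar>)"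
    by (rule order_trans[OF sum_abs sum_mono[OF sum_abs]])
  also have "\<dots> \<le> (\<Sum>i\<in>{1..N}. \<Sum>j\<in>{i<..N}. norm (y - z) / r\<^sup>2)"
    using d by (intro sum_mono) auto
  also have "\<dots> \<le> (\<Sum>i\<in>{1..N}. \<Sum>j\<in>{1..N}. norm (y - z) / r\<^sup>2)"
    by (intro sum_mono sum_mono2) auto
  also have "\<dots> = (real N)\<^sup>2 / r\<^sup>2 * norm (y - z)"
    by (simp add: power2_eq_square)
  finally show ?thesis .
qed

section \<open>Order, Lipschitz and limit properties of the transform\<close>

lemma feasible_ctrans_arg:
  assumes "feasible N r \<psi>" "k \<in> {1..N}"
  shows "\<psi> y \<le> real N * trunc_cost N r (x(k := y)) - (\<Sum>i\<in>{1..N} - {k}. \<psi> (x i))"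
proof -
  have "(\<Sum>i\<in>{1..N}. \<psi> ((x(k := y)) i)) \<le> real N * trunc_cost N r (x(k := y))"
    using assms(1) unfolding feasible_def by blast
  also have "(\<Sum>i\<in>{1..N}. \<psi> ((x(k := y)) i)) = \<psi> y + (\<Sum>i\<in>{1..N} - {k}. \<psi> (x i))"
    using assms(2) by (subst sum.remove[of _ k]) (auto intro!: sum.cong)
  finally show ?thesis by linarith
qed

text \<open>A real infimum is a lower bound only for a set that is bounded below. Here this holds
  because the cost is nonnegative and the subtracted potentials are bounded above.\<close>

lemma ctrans_bdd_below:
  fixes \<psi> :: "'a::real_normed_vector option \<Rightarrow> real"
  assumes "r > 0" "bdd_above (range \<psi>)"
  shows "bdd_below ((\<lambda>(k, x). real N * trunc_cost N r (x(k := y)) - (\<Sum>i\<in>{1..N} - {k}. \<psi> (x i)))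
                     ` ({1..N} \<times> UNIV))"
proof -
  obtain B where B: "\<psi> z \<le> B" for z using assms(2) by (auto simp: bdd_above_def)
  show ?thesis
  proof (rule bdd_belowI2[where m = "- (real N * \<bar>B\<bar>)"], clarify)
    fix k and x :: "nat \<Rightarrow> 'a option" assume k: "k \<in> {1..N}"
    have "(\<Sum>i\<in>{1..N} - {k}. \<psi> (x i)) \<le> (\<Sum>i\<in>{1..N} - {k}. \<bar>B\<bar>)"
      using B by (intro sum_mono) (meson abs_ge_self order_trans)
    also have "\<dots> \<le> (\<Sum>i\<in>{1..N}. \<bar>B\<bar>)" by (intro sum_mono2) auto
    finally have "(\<Sum>i\<in>{1..N} - {k}. \<psi> (x i)) \<le> real N * \<bar>B\<bar>" by simp
    moreover have "0 \<le> real N * trunc_cost N r (x(k := y))" by (intro mult_nonneg_nonneg trunc_cost_nonneg assms) simp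
    ultimately show "- (real N * \<bar>B\<bar>)
        \<le> real N * trunc_cost N r (x(k := y)) - (\<Sum>i\<in>{1..N} - {k}. \<psi> (x i))" by linarith
  qed
qed

lemma ctrans_lower:
  assumes "r > 0" "bdd_above (range \<psi>)" "k \<in> {1..N}"
  shows "ctrans N r \<psi> y \<le> real N * trunc_cost N r (x(k := y)) - (\<Sum>i\<in>{1..N} - {k}. \<psi> (x i))"
  unfolding ctrans_def
  using cINF_lower[OF ctrans_bdd_below[OF assms(1,2)], of "(k, x)"] assms(3) by auto

lemma ctrans_greatest:
  assumes "N \<ge> 1"
    and "\<And>k x. k \<in> {1..N} \<Longrightarrow>
           m \<le> real N * trunc_cost N r (x(k := y)) - (\<Sum>i\<in>{1..N} - {k}. \<psi> (x i))"
  shows "m \<le> ctrans N r \<psi> y"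
  unfolding ctrans_def using assms by (intro cINF_greatest) auto

lemma ctrans_lessE:
  assumes "N \<ge> 1" "ctrans N r \<psi> y < m"
  obtains k x where "k \<in> {1..N}"
    "real N * trunc_cost N r (x(k := y)) - (\<Sum>i\<in>{1..N} - {k}. \<psi> (x i)) < m"
  using ctrans_greatest[OF assms(1), of m r y \<psi>] assms(2) by (meson not_le)

lemma le_ctrans:
  assumes "N \<ge> 1" "feasible N r \<psi>"
  shows "\<psi> y \<le> ctrans N r \<psi> y"
  using assms by (intro ctrans_greatest feasible_ctrans_arg) auto

lemma ctrans_antimono:
  assumes "N \<ge> 1" "r > 0" "bdd_above (range \<psi>')" "\<And>z. \<psi> z \<le> \<psi>' z"
  shows "ctrans N r \<psi>' y \<le> ctrans N r \<psi> y"
proof (rule ctrans_greatest[OF assms(1)])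
  fix k and x :: "nat \<Rightarrow> 'a option" assume k: "k \<in> {1..N}"
  have "(\<Sum>i\<in>{1..N} - {k}. \<psi> (x i)) \<le> (\<Sum>i\<in>{1..N} - {k}. \<psi>' (x i))"
    using assms(4) by (intro sum_mono)
  with ctrans_lower[OF assms(2,3) k, where y=y and x=x]
  show "ctrans N r \<psi>' y \<le> real N * trunc_cost N r (x(k := y)) - (\<Sum>i\<in>{1..N} - {k}. \<psi> (x i))"
    by linarith
qed

text \<open>An infimum of functions with a common Lipschitz constant keeps that constant, here N
  times the one of \<open>trunc_cost_lipschitz\<close>.\<close>

lemma ctrans_lipschitz:
  assumes "N \<ge> 1" "r > 0" "bdd_above (range \<psi>)"
  shows "(real N ^ 3 / r\<^sup>2)-lipschitz_on UNIV (\<lambda>y. ctrans N r \<psi> (Some y))"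
proof -
  have le: "ctrans N r \<psi> (Some y) - real N ^ 3 / r\<^sup>2 * norm (y - z) \<le> ctrans N r \<psi> (Some z)" for y z
  proof (rule ctrans_greatest[OF assms(1)])
    fix k and x :: "nat \<Rightarrow> 'a option" assume k: "k \<in> {1..N}"
    have "real N * (trunc_cost N r (x(k := Some y)) - trunc_cost N r (x(k := Some z)))
          \<le> real N * ((real N)\<^sup>2 / r\<^sup>2 * norm (y - z))"
      using trunc_cost_lipschitz[OF assms(2), of N x k y z] by (intro mult_left_mono) auto
    also have "\<dots> = real N ^ 3 / r\<^sup>2 * norm (y - z)" by (simp add: power2_eq_square power3_eq_cube)
    finally show "ctrans N r \<psi> (Some y) - real N ^ 3 / r\<^sup>2 * norm (y - z)
          \<le> real N * trunc_cost N r (x(k := Some z)) - (\<Sum>i\<in>{1..N} - {k}. \<psi> (x i))"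
      using ctrans_lower[OF assms(2,3) k, where y="Some y" and x=x] by (simp add: right_diff_distrib)
  qed
  show ?thesis
  proof (rule lipschitz_onI)
    fix y z :: 'a
    show "dist (ctrans N r \<psi> (Some y)) (ctrans N r \<psi> (Some z)) \<le> real N ^ 3 / r\<^sup>2 * dist y z"
      using le[of y z] le[of z y] by (simp add: dist_norm norm_minus_commute abs_le_iff)
  qed (use assms in auto)
qed

text \<open>The lower bound holds at every point, since \<open>None\<close> minimizes the cost in
  each slot. The upper bound uses the convergence of the cost for one fixed, nearly optimal
  competitor.\<close>

lemma ctrans_tendsto_None:
  assumes "N \<ge> 1" "r > 0" "bdd_above (range \<psi>)"
  shows "((\<lambda>y. ctrans N r \<psi> (Some y)) \<longlongrightarrow> ctrans N r \<psi> None) at_infinity"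
proof (rule order_tendstoI)
  fix a assume a: "a < ctrans N r \<psi> None"
  have "ctrans N r \<psi> None \<le> ctrans N r \<psi> (Some y)" for y
  proof (rule ctrans_greatest[OF assms(1)])
    fix k and x :: "nat \<Rightarrow> 'a option" assume k: "k \<in> {1..N}"
    have "real N * trunc_cost N r (x(k := None)) \<le> real N * trunc_cost N r (x(k := Some y))"
      using trunc_cost_None_le[OF assms(2)] by (intro mult_left_mono) auto
    then show "ctrans N r \<psi> None
        \<le> real N * trunc_cost N r (x(k := Some y)) - (\<Sum>i\<in>{1..N} - {k}. \<psi> (x i))"
      using ctrans_lower[OF assms(2,3) k, where y=None and x=x] by linarith
  qed
  then show "eventually (\<lambda>y. a < ctrans N r \<psi> (Some y)) at_infinity"
    using a by (intro always_eventually) (auto intro: less_le_trans)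
next
  fix a assume "ctrans N r \<psi> None < a"
  then obtain k x where k: "k \<in> {1..N}"
    and kx: "real N * trunc_cost N r (x(k := None)) - (\<Sum>i\<in>{1..N} - {k}. \<psi> (x i)) < a"
    by (rule ctrans_lessE[OF assms(1)])
  have "((\<lambda>y. real N * trunc_cost N r (x(k := Some y)) - (\<Sum>i\<in>{1..N} - {k}. \<psi> (x i))) \<longlongrightarrow>
         real N * trunc_cost N r (x(k := None)) - (\<Sum>i\<in>{1..N} - {k}. \<psi> (x i))) at_infinity"
    by (intro tendsto_intros trunc_cost_tendsto_None assms)
  then have "eventually (\<lambda>y. real N * trunc_cost N r (x(k := Some y)) - (\<Sum>i\<in>{1..N} - {k}. \<psi> (x i)) < a)
      at_infinity" using kx by (rule order_tendstoD)
  then show "eventually (\<lambda>y. ctrans N r \<psi> (Some y) < a) at_infinity"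
    by eventually_elim (use ctrans_lower[OF assms(2,3) k] in \<open>auto intro: le_less_trans\<close>)
qed

text \<open>With the other N - 1 arguments at infinity no pair interacts and the cost vanishes. The
  value at infinity thus controls the whole potential from above.\<close>

lemma feasible_at_most:
  assumes "N \<ge> 1" "feasible N r \<psi>"
  shows "\<psi> y \<le> - (real N - 1) * \<psi> None"
proof -
  have "trunc_cost N r ((\<lambda>_. None)(1 := y)) = 0"
    unfolding trunc_cost_def by (intro sum.neutral) auto
  then show ?thesis
    using feasible_ctrans_arg[OF assms(2), of 1 y "\<lambda>_. None"] assms(1) by (simp add: algebra_simps)
qed

lemma feasible_bdd_above: "N \<ge> 1 \<Longrightarrow> feasible N r \<psi> \<Longrightarrow> bdd_above (range \<psi>)"
  by (rule bdd_aboveI2[where M = "- (real N - 1) * \<psi> None"]) (rule feasible_at_most)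

text \<open>Replacing one argument at a time by its transform and averaging over the arguments keeps
  the symmetric constraint.\<close>

lemma feasible_average:
  assumes "N \<ge> 1" "r > 0" "feasible N r \<psi>"
  shows "feasible N r (\<lambda>y. (ctrans N r \<psi> y + (real N - 1) * \<psi> y) / real N)"
  unfolding feasible_def
proof
  fix x :: "nat \<Rightarrow> 'a option"
  let ?c = "trunc_cost N r x" and ?S = "\<Sum>i\<in>{1..N}. \<psi> (x i)"
  have "ctrans N r \<psi> (x k) \<le> real N * ?c - (?S - \<psi> (x k))" if k: "k \<in> {1..N}" for k
  proof -
    have "(\<Sum>i\<in>{1..N} - {k}. \<psi> (x i)) = ?S - \<psi> (x k)"
      using k by (simp add: sum_diff1)
    then show ?thesis
      using ctrans_lower[OF assms(2) feasible_bdd_above[OF assms(1,3)] k, of "x k" x] by simp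
  qed
  then have "(\<Sum>k\<in>{1..N}. ctrans N r \<psi> (x k)) \<le> (\<Sum>k\<in>{1..N}. real N * ?c - (?S - \<psi> (x k)))"
    by (intro sum_mono)
  also have "\<dots> = real N * real N * ?c - real N * ?S + ?S"
    by (simp add: sum_subtractf sum.distrib algebra_simps)
  finally have "(\<Sum>k\<in>{1..N}. ctrans N r \<psi> (x k)) + (real N - 1) * ?S \<le> real N * (real N * ?c)"
    by (simp add: algebra_simps)
  then have "((\<Sum>k\<in>{1..N}. ctrans N r \<psi> (x k)) + (real N - 1) * ?S) / real N \<le> real N * ?c"
    using assms(1) by (subst pos_divide_le_eq) (simp_all add: mult.commute)
  moreover have "(\<Sum>i\<in>{1..N}. (ctrans N r \<psi> (x i) + (real N - 1) * \<psi> (x i)) / real N)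
     = ((\<Sum>k\<in>{1..N}. ctrans N r \<psi> (x k)) + (real N - 1) * ?S) / real N"
    by (simp add: sum_divide_distrib[symmetric] sum.distrib sum_distrib_left)
  ultimately show "(\<Sum>i\<in>{1..N}. (ctrans N r \<psi> (x i) + (real N - 1) * \<psi> (x i)) / real N)
      \<le> real N * ?c"
    by simp
qed

lemma feasible_limit:
  assumes "\<And>n. feasible N r (u n)" "\<And>y. (\<lambda>n. u n y) \<longlonglongrightarrow> v y"
  shows "feasible N r v"
  unfolding feasible_def
proof
  fix x :: "nat \<Rightarrow> 'a option"
  have "(\<lambda>n. \<Sum>i\<in>{1..N}. u n (x i)) \<longlonglongrightarrow> (\<Sum>i\<in>{1..N}. v (x i))" by (intro tendsto_sum assms)
  then show "(\<Sum>i\<in>{1..N}. v (x i)) \<le> real N * trunc_cost N r x"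
    by (rule LIMSEQ_le_const2) (use assms(1) in \<open>auto simp: feasible_def\<close>)
qed

text \<open>An averaging step raises \<phi> by (\<open>ctrans N r \<phi>\<close> - \<phi>) / N,
  which is nonnegative, so a finite limit of the iterates can only be a fixed point.\<close>

lemma feasible_fixpoint_above:
  fixes \<psi> :: "'a::real_normed_vector option \<Rightarrow> real"
  assumes N: "N \<ge> 1" and r: "r > 0" and \<psi>: "feasible N r \<psi>"
  obtains u where "feasible N r u" "\<And>y. \<psi> y \<le> u y" "ctrans N r u = u"
proof -
  define T where "T = (\<lambda>(\<phi> :: 'a option \<Rightarrow> real) y. (ctrans N r \<phi> y + (real N - 1) * \<phi> y) / real N)"
  define P where "P = (\<lambda>k. (T ^^ k) \<psi>)"
  have P0: "P 0 = \<psi>" and PS: "P (Suc k) = T (P k)" for k by (auto simp: P_def)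
  have feas: "feasible N r (P k)" for k
    by (induction k) (simp_all add: P0 PS T_def \<psi> feasible_average[OF N r])
  have step: "P k y \<le> P (Suc k) y" for k y
    using le_ctrans[OF N feas[of k], of y] N by (simp add: PS T_def field_simps)
  have inc: "incseq (\<lambda>k. P k y)" for y using step by (rule incseq_SucI)
  \<comment> \<open>The value at infinity grows along the iteration, so the bound of
    \<open>feasible_at_most\<close> for the starting potential serves for all iterates.\<close>
  define B where "B = - (real N - 1) * \<psi> None"
  have bound: "P k y \<le> B" for k y
  proof -
    have "\<psi> None \<le> P k None" using incseqD[OF inc, of 0 k] P0 by simp
    then have "- (real N - 1) * P k None \<le> B"
      using N unfolding B_def by (intro mult_left_mono_neg) auto
    then show ?thesis using feasible_at_most[OF N feas[of k], of y] by linarith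
  qed
  have "\<exists>L. (\<lambda>k. P k y) \<longlonglongrightarrow> L" for y
    by (rule incseq_convergent[OF inc, of y B]) (use bound in auto)
  then obtain u where lim: "\<And>y. (\<lambda>k. P k y) \<longlonglongrightarrow> u y" by metis
  have Pu: "P k y \<le> u y" for k y using incseq_le[OF inc lim] .
  have fu: "feasible N r u" by (rule feasible_limit[OF feas lim])
  have "ctrans N r u y = u y" for y
  proof (rule antisym)
    show "u y \<le> ctrans N r u y" by (rule le_ctrans[OF N fu])
    \<comment> \<open>As \<open>u\<close> lies above each iterate, its transform lies below theirs.
      Solving the definition of \<open>T\<close> for the transform leaves two consecutive iterates,
      both converging to \<open>u y\<close>.\<close>
    have "ctrans N r u y \<le> real N * P (Suc k) y - (real N - 1) * P k y" for k
    proof -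
      have "ctrans N r u y \<le> ctrans N r (P k) y" by (intro ctrans_antimono[OF N r feasible_bdd_above[OF N fu]] Pu)
      also have "\<dots> = real N * P (Suc k) y - (real N - 1) * P k y"
        using N by (simp add: PS T_def)
      finally show ?thesis .
    qed
    moreover have "(\<lambda>k. real N * P (Suc k) y - (real N - 1) * P k y)
        \<longlonglongrightarrow> real N * u y - (real N - 1) * u y"
      by (intro tendsto_intros lim LIMSEQ_Suc)
    ultimately have "ctrans N r u y \<le> real N * u y - (real N - 1) * u y"
      by (intro LIMSEQ_le_const) auto
    then show "ctrans N r u y \<le> u y" by (simp add: algebra_simps)
  qed
  then have "ctrans N r u = u" by (rule ext)
  moreover have "\<psi> y \<le> u y" for y using Pu[of 0 y] by (simp add: P0)
  ultimately show ?thesis using that[OF fu] by blast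
qed

section \<open>Admissible potentials\<close>

lemma value_at_infinity_eq:
  fixes \<psi> :: "'a::euclidean_space \<Rightarrow> real"
  shows "(\<psi> \<longlongrightarrow> l) at_infinity \<Longrightarrow> value_at_infinity \<psi> = l"
  unfolding value_at_infinity_def by (rule tendsto_Lim[OF trivial_limit_at_infinity])

lemma C0_plus_const_iff:
  fixes \<psi> :: "'a::euclidean_space \<Rightarrow> real"
  shows "\<psi> \<in> C0_plus_const \<longleftrightarrow>
           continuous_on UNIV \<psi> \<and> (\<psi> \<longlongrightarrow> value_at_infinity \<psi>) at_infinity"
proof
  assume "\<psi> \<in> C0_plus_const"
  then obtain \<phi> \<kappa> where \<phi>: "continuous_on UNIV \<phi>" "(\<phi> \<longlongrightarrow> 0) at_infinity" and \<psi>: "\<psi> = (\<lambda>x. \<phi> x + \<kappa>)"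
    by (auto simp: C0_plus_const_def C0_def)
  have "(\<psi> \<longlongrightarrow> 0 + \<kappa>) at_infinity" unfolding \<psi> by (intro tendsto_intros \<phi>)
  then show "continuous_on UNIV \<psi> \<and> (\<psi> \<longlongrightarrow> value_at_infinity \<psi>) at_infinity"
    using \<phi>(1) by (simp add: value_at_infinity_eq) (simp add: \<psi> continuous_intros)
next
  assume *: "continuous_on UNIV \<psi> \<and> (\<psi> \<longlongrightarrow> value_at_infinity \<psi>) at_infinity"
  let ?l = "value_at_infinity \<psi>"
  have "((\<lambda>x. \<psi> x - ?l) \<longlongrightarrow> ?l - ?l) at_infinity" using * by (intro tendsto_intros) auto
  then have "(\<lambda>x. \<psi> x - ?l) \<in> C0" using * by (auto simp: C0_def intro!: continuous_intros)
  then show "\<psi> \<in> C0_plus_const"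
    unfolding C0_plus_const_def by (intro CollectI bexI[of _ "\<lambda>x. \<psi> x - ?l"] exI[of _ ?l]) auto
qed

lemma C0_plus_const_bounded:
  fixes \<psi> :: "'a::euclidean_space \<Rightarrow> real"
  assumes "\<psi> \<in> C0_plus_const"
  obtains B where "B > 0" "\<And>x. \<bar>\<psi> x\<bar> \<le> B"
proof -
  let ?l = "value_at_infinity \<psi>"
  have cont: "continuous_on UNIV \<psi>" and lim: "(\<psi> \<longlongrightarrow> ?l) at_infinity"
    using assms by (auto simp: C0_plus_const_iff)
  have "eventually (\<lambda>x. dist (\<psi> x) ?l < 1) at_infinity" using lim by (rule tendstoD) simp
  then obtain b where b: "\<And>x. b \<le> norm x \<Longrightarrow> dist (\<psi> x) ?l < 1"
    by (auto simp: eventually_at_infinity)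
  have "compact (\<psi> ` cball 0 b)"
    by (intro compact_continuous_image continuous_on_subset[OF cont] compact_cball) auto
  then obtain B where B: "\<And>x. x \<in> cball 0 b \<Longrightarrow> \<bar>\<psi> x\<bar> \<le> B"
    by (fastforce dest!: compact_imp_bounded simp: bounded_iff)
  show ?thesis
  proof (rule that[of "max \<bar>B\<bar> \<bar>?l\<bar> + 1"])
    fix x show "\<bar>\<psi> x\<bar> \<le> max \<bar>B\<bar> \<bar>?l\<bar> + 1"
      using b[of x] B[of x] by (cases "b \<le> norm x") (auto simp: dist_real_def)
  qed auto
qed

section \<open>Passing between the Coulomb constraint and the truncated one\<close>

lemma trunc_cost_le_coulomb_cost:
  assumes "r > 0"
  shows "ennreal (trunc_cost N r (\<lambda>i. Some (x i))) \<le> coulomb_cost N x"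
proof -
  \<comment> \<open>At t = 0 the right-hand side is \<open>top\<close>; elsewhere the maximum only
    enlarges the denominator.\<close>
  have "ennreal (1 / max r t) \<le> 1 / ennreal t" if "t \<ge> 0" for t
  proof (cases "t = 0")
    case False
    then have "1 / ennreal t = ennreal (1 / t)" using that divide_ennreal[of 1 t] by simp
    then show ?thesis using False that assms by (auto intro!: ennreal_leI divide_left_mono)
  qed simp
  then have "(\<Sum>i\<in>{1..N}. \<Sum>j\<in>{i<..N}. ennreal (trunc_kernel r (Some (x i)) (Some (x j))))
      \<le> coulomb_cost N x"
    unfolding coulomb_cost_def by (intro sum_mono) auto
  also have "(\<Sum>i\<in>{1..N}. \<Sum>j\<in>{i<..N}. ennreal (trunc_kernel r (Some (x i)) (Some (x j))))
      = ennreal (trunc_cost N r (\<lambda>i. Some (x i)))"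
    unfolding trunc_cost_def
    by (simp add: sum_ennreal[symmetric] sum_nonneg trunc_kernel_nonneg[OF assms] del: sum_ennreal trunc_kernel_simps)
  finally show ?thesis .
qed

lemma coulomb_cost_eq_trunc_cost:
  assumes "r > 0" "\<And>i j. i \<in> {1..N} \<Longrightarrow> j \<in> {i<..N} \<Longrightarrow> r \<le> norm (x i - x j)"
  shows "coulomb_cost N x = ennreal (trunc_cost N r (\<lambda>i. Some (x i)))"
proof -
  have "1 / ennreal (norm (x i - x j)) = ennreal (trunc_kernel r (Some (x i)) (Some (x j)))"
    if "i \<in> {1..N}" "j \<in> {i<..N}" for i j
  proof -
    have "0 < norm (x i - x j)" using assms(2)[OF that] assms(1) by linarith
    then show ?thesis
      using assms(2)[OF that] divide_ennreal[of 1 "norm (x i - x j)"] by (simp add: max_def)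
  qed
  then have "coulomb_cost N x
      = (\<Sum>i\<in>{1..N}. \<Sum>j\<in>{i<..N}. ennreal (trunc_kernel r (Some (x i)) (Some (x j))))"
    unfolding coulomb_cost_def by (intro sum.cong refl) auto
  then show ?thesis
    unfolding trunc_cost_def
    by (simp add: sum_ennreal[symmetric] sum_nonneg trunc_kernel_nonneg[OF assms(1)] del: sum_ennreal trunc_kernel_simps)
qed

text \<open>The untruncated constraint gives the truncated one: if two arguments are closer than \<open>r\<close>,
  their interaction alone is at least the upper bound \<open>1 / r\<close> of the potential.\<close>

lemma admissible_truncated:
  fixes \<psi> :: "'a::euclidean_space \<Rightarrow> real"
  assumes N: "N \<ge> 1" and r: "r > 0" and \<psi>: "\<psi> \<in> admissible N" and le: "\<And>x. \<psi> x \<le> 1 / r"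
  shows "(\<Sum>i\<in>{1..N}. \<psi> (x i)) \<le> real N * trunc_cost N r (\<lambda>i. Some (x i))"
proof (cases "\<forall>i\<in>{1..N}. \<forall>j\<in>{i<..N}. r \<le> norm (x i - x j)")
  case True
  have "ereal (1 / real N * (\<Sum>i\<in>{1..N}. \<psi> (x i))) \<le> enn2ereal (coulomb_cost N x)"
    using \<psi> by (auto simp: admissible_def)
  also have "\<dots> = ereal (trunc_cost N r (\<lambda>i. Some (x i)))"
    using True by (subst coulomb_cost_eq_trunc_cost[OF r]) (auto simp: enn2ereal_ennreal trunc_cost_nonneg[OF r])
  finally show ?thesis using N by (simp add: field_simps)
next
  case False
  then obtain i j where ij: "i \<in> {1..N}" "j \<in> {i<..N}" "norm (x i - x j) < r" by (auto simp: not_le)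
  let ?g = "\<lambda>i j. trunc_kernel r (Some (x i)) (Some (x j))"
  have "1 / r = ?g i j" using ij by (simp add: max_def)
  also have "\<dots> \<le> (\<Sum>j\<in>{i<..N}. ?g i j)"
    using ij by (intro member_le_sum trunc_kernel_nonneg r) auto
  also have "\<dots> \<le> trunc_cost N r (\<lambda>i. Some (x i))"
    unfolding trunc_cost_def
    using ij by (intro member_le_sum[where f = "\<lambda>i. \<Sum>j\<in>{i<..N}. ?g i j"] sum_nonneg trunc_kernel_nonneg r) auto
  finally have "real N * (1 / r) \<le> real N * trunc_cost N r (\<lambda>i. Some (x i))"
    by (intro mult_left_mono) auto
  moreover have "(\<Sum>i\<in>{1..N}. \<psi> (x i)) \<le> (\<Sum>i\<in>{1..N}. 1 / r)" using le by (intro sum_mono)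
  ultimately show ?thesis by simp
qed

definition extend_inf :: "('a::real_normed_vector \<Rightarrow> real) \<Rightarrow> 'a option \<Rightarrow> real" where
  "extend_inf \<psi> = case_option (value_at_infinity \<psi>) \<psi>"

lemma extend_inf_simps [simp]:
  "extend_inf \<psi> None = value_at_infinity \<psi>" "extend_inf \<psi> (Some x) = \<psi> x"
  by (auto simp: extend_inf_def)

text \<open>Induction on the number of arguments at infinity: one of them is replaced by a finite
  point y, and then y tends to infinity, where potential and truncated cost both converge.\<close>

lemma admissible_feasible:
  fixes \<psi> :: "'a::euclidean_space \<Rightarrow> real"
  assumes N: "N \<ge> 1" and r: "r > 0" and \<psi>: "\<psi> \<in> admissible N" and le: "\<And>x. \<psi> x \<le> 1 / r"
  shows "feasible N r (extend_inf \<psi>)"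
proof -
  have lim: "(\<psi> \<longlongrightarrow> value_at_infinity \<psi>) at_infinity"
    using \<psi> by (auto simp: admissible_def C0_plus_const_iff)
  have "(\<Sum>i\<in>{1..N}. extend_inf \<psi> (x i)) \<le> real N * trunc_cost N r x" for x
  proof (induction "card {i \<in> {1..N}. x i = None}" arbitrary: x)
    case 0
    then have "x i \<noteq> None" if "i \<in> {1..N}" for i using that by auto
    then have eq: "x i = Some (the (x i))" if "i \<in> {1..N}" for i using that by auto
    have "(\<Sum>i\<in>{1..N}. extend_inf \<psi> (x i)) = (\<Sum>i\<in>{1..N}. \<psi> (the (x i)))"
      using eq by (intro sum.cong refl) (metis extend_inf_simps(2))
    moreover have "trunc_cost N r (\<lambda>i. Some (the (x i))) = trunc_cost N r x"
      unfolding trunc_cost_def using eq by (intro sum.cong refl) auto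
    ultimately show ?case using admissible_truncated[OF N r \<psi> le, of "\<lambda>i. the (x i)"] by simp
  next
    case (Suc m)
    then have "{i \<in> {1..N}. x i = None} \<noteq> {}" by (metis card.empty nat.distinct(1))
    then obtain k where k: "k \<in> {1..N}" "x k = None" by auto
    have "(\<Sum>i\<in>{1..N}. extend_inf \<psi> ((x(k := Some y)) i))
            \<le> real N * trunc_cost N r (x(k := Some y))" for y
    proof (rule Suc.hyps(1))
      have "{i \<in> {1..N}. (x(k := Some y)) i = None} = {i \<in> {1..N}. x i = None} - {k}" by auto
      then show "m = card {i \<in> {1..N}. (x(k := Some y)) i = None}"
        using Suc.hyps(2) k by simp
    qed
    moreover have "((\<lambda>y. \<Sum>i\<in>{1..N}. extend_inf \<psi> ((x(k := Some y)) i)) \<longlongrightarrow>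
        (\<Sum>i\<in>{1..N}. extend_inf \<psi> ((x(k := None)) i))) at_infinity"
    proof (intro tendsto_sum)
      fix i show "((\<lambda>y. extend_inf \<psi> ((x(k := Some y)) i)) \<longlongrightarrow> extend_inf \<psi> ((x(k := None)) i)) at_infinity"
        using lim by (cases "i = k") auto
    qed
    moreover have "((\<lambda>y. real N * trunc_cost N r (x(k := Some y))) \<longlongrightarrow>
        real N * trunc_cost N r (x(k := None))) at_infinity"
      by (intro tendsto_intros trunc_cost_tendsto_None r)
    ultimately have "(\<Sum>i\<in>{1..N}. extend_inf \<psi> ((x(k := None)) i))
        \<le> real N * trunc_cost N r (x(k := None))"
      by (intro tendsto_le[OF trivial_limit_at_infinity]) auto
    moreover have "x(k := None) = x" using k(2) by auto
    ultimately show ?case by simp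
  qed
  then show ?thesis by (auto simp: feasible_def)
qed

text \<open>The way back from the compactification: a fixed point inherits the regularity of the
  transform, and the truncated cost lies below the Coulomb cost.\<close>

lemma fixpoint_admissible:
  fixes u :: "'a::euclidean_space option \<Rightarrow> real"
  assumes N: "N \<ge> 1" and r: "r > 0" and u: "feasible N r u" "ctrans N r u = u"
  shows "(\<lambda>x. u (Some x)) \<in> admissible N"
    and "(real N ^ 3 / r\<^sup>2)-lipschitz_on UNIV (\<lambda>x. u (Some x))"
    and "value_at_infinity (\<lambda>x. u (Some x)) = u None"
proof -
  note bdd = feasible_bdd_above[OF N u(1)]
  show lip: "(real N ^ 3 / r\<^sup>2)-lipschitz_on UNIV (\<lambda>x. u (Some x))"
    using ctrans_lipschitz[OF N r bdd] u(2) by simp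
  have lim: "((\<lambda>x. u (Some x)) \<longlongrightarrow> u None) at_infinity"
    using ctrans_tendsto_None[OF N r bdd] u(2) by simp
  show val: "value_at_infinity (\<lambda>x. u (Some x)) = u None" using lim by (rule value_at_infinity_eq)
  have "ereal (1 / real N * (\<Sum>i\<in>{1..N}. u (Some (x i)))) \<le> enn2ereal (coulomb_cost N x)" for x
  proof -
    have "1 / real N * (\<Sum>i\<in>{1..N}. u (Some (x i))) \<le> trunc_cost N r (\<lambda>i. Some (x i))"
      using u(1) N unfolding feasible_def by (simp add: field_simps)
    then have "ereal (1 / real N * (\<Sum>i\<in>{1..N}. u (Some (x i)))) \<le> enn2ereal (ennreal (trunc_cost N r (\<lambda>i. Some (x i))))"
      by (simp add: enn2ereal_ennreal trunc_cost_nonneg[OF r])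
    also have "\<dots> \<le> enn2ereal (coulomb_cost N x)"
      using trunc_cost_le_coulomb_cost[OF r] less_eq_ennreal.rep_eq by blast
    finally show ?thesis .
  qed
  moreover have "(\<lambda>x. u (Some x)) \<in> C0_plus_const"
    using lipschitz_on_continuous_on[OF lip] lim val by (simp add: C0_plus_const_iff)
  ultimately show "(\<lambda>x. u (Some x)) \<in> admissible N" by (auto simp: admissible_def)
qed

text \<open>Both bounds come from N - 1 arguments placed at infinity. They do not involve r, so any
  radius fit for \<open>admissible_feasible\<close> will do, here 1 / B with B a bound of the
  absolute value.\<close>

lemma admissible_at_infinity_bounds:
  fixes \<psi> :: "'a::euclidean_space \<Rightarrow> real"
  assumes N: "N \<ge> 1" and \<psi>: "\<psi> \<in> admissible N"
  shows "\<psi> x \<le> - (real N - 1) * value_at_infinity \<psi>" "value_at_infinity \<psi> \<le> 0"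
proof -
  obtain B where B: "B > 0" "\<And>x. \<bar>\<psi> x\<bar> \<le> B"
    using \<psi> C0_plus_const_bounded[of \<psi>] by (auto simp: admissible_def)
  have "feasible N (1 / B) (extend_inf \<psi>)"
    by (rule admissible_feasible[OF N _ \<psi>]) (use B in \<open>auto simp: abs_le_iff\<close>)
  note * = feasible_at_most[OF N this]
  show "\<psi> x \<le> - (real N - 1) * value_at_infinity \<psi>" using *[of "Some x"] by simp
  have "real N * value_at_infinity \<psi> \<le> 0" using *[of None] by (simp add: algebra_simps)
  then show "value_at_infinity \<psi> \<le> 0" using N by (simp add: mult_le_0_iff)
qed

lemma admissible_regularize:
  fixes \<psi> :: "'a::euclidean_space \<Rightarrow> real"
  assumes N: "N \<ge> 1" and r: "r > 0" and \<psi>: "\<psi> \<in> admissible N" and le: "\<And>x. \<psi> x \<le> 1 / r"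
  obtains u where "feasible N r u" "ctrans N r u = u" "\<And>x. \<psi> x \<le> u (Some x)" "value_at_infinity \<psi> \<le> u None"
proof -
  obtain u where "feasible N r u" "\<And>y. extend_inf \<psi> y \<le> u y" "ctrans N r u = u"
    using feasible_fixpoint_above[OF N r admissible_feasible[OF N r \<psi> le]] by blast
  then show ?thesis using that extend_inf_simps by metis
qed

text \<open>A competitor of dual value 0, which keeps the supremum nonnegative.\<close>

lemma zero_admissible: "(\<lambda>_::'a::euclidean_space. 0) \<in> admissible N"
proof -
  have "value_at_infinity (\<lambda>_::'a. 0) = 0" by (rule value_at_infinity_eq) simp
  then show ?thesis
    by (simp add: admissible_def C0_plus_const_iff zero_ereal_def[symmetric] enn2ereal_nonneg)
qed

section \<open>Weak duality\<close>

lemma integral_scale_measure: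
  fixes f :: "'a \<Rightarrow> real"
  assumes "f \<in> borel_measurable M" "c \<ge> 0"
  shows "(\<integral>x. f x \<partial>scale_measure (ennreal c) M) = c * (\<integral>x. f x \<partial>M)"
proof -
  have "scale_measure (ennreal c) M = density M (\<lambda>_. ennreal c)"
    by (rule measure_eqI) (auto simp: emeasure_density_const)
  then show ?thesis using assms by (simp add: integral_density)
qed

lemma borel_subprobs_finite: "\<rho> \<in> borel_subprobs \<Longrightarrow> finite_measure \<rho>"
  by (rule finite_measureI) (auto simp: borel_subprobs_def top_unique dest: sets_eq_imp_space_eq)

lemma borel_probs_subprobs: "borel_probs \<subseteq> borel_subprobs"
  using prob_space.emeasure_space_1
  by (fastforce simp: borel_subprobs_def borel_probs_def dest: sets_eq_imp_space_eq)

lemma borel_subprobs_space: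
  fixes \<rho> :: "'a::topological_space measure"
  shows "\<rho> \<in> borel_subprobs \<Longrightarrow> space \<rho> = UNIV"
  using sets_eq_imp_space_eq[of \<rho> borel] by (auto simp: borel_subprobs_def)

lemma bounded_continuous_integrable:
  fixes \<psi> :: "'a::topological_space \<Rightarrow> real"
  assumes "\<rho> \<in> borel_subprobs" "continuous_on UNIV \<psi>" "\<And>x. \<bar>\<psi> x\<bar> \<le> B"
  shows "integrable \<rho> \<psi>"
proof -
  have "\<psi> \<in> borel_measurable \<rho>"
    using assms(1) borel_measurable_continuous_onI[OF assms(2)]
    by (simp add: borel_subprobs_def measurable_cong_sets[of \<rho> borel])
  then show ?thesis
    by (intro finite_measure.integrable_const_bound[OF borel_subprobs_finite[OF assms(1)], of _ B])
       (use assms(3) in auto)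
qed

lemma C0_plus_const_integrable:
  fixes \<psi> :: "'a::euclidean_space \<Rightarrow> real"
  assumes "\<rho> \<in> borel_subprobs" "\<psi> \<in> C0_plus_const"
  shows "integrable \<rho> \<psi>"
  using C0_plus_const_bounded[OF assms(2)] bounded_continuous_integrable[OF assms(1)] assms(2)
  by (metis C0_plus_const_iff)

lemma C0_subset_C0_plus_const: "C0 \<subseteq> C0_plus_const"
  by (force simp: C0_plus_const_def)

lemma C0_plus_const_minus_value_at_infinity:
  fixes \<psi> :: "'a::euclidean_space \<Rightarrow> real"
  assumes "\<psi> \<in> C0_plus_const"
  shows "(\<lambda>x. \<psi> x - value_at_infinity \<psi>) \<in> C0"
proof -
  have "((\<lambda>x. \<psi> x - value_at_infinity \<psi>) \<longlongrightarrow> value_at_infinity \<psi> - value_at_infinity \<psi>) at_infinity"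
    using assms by (intro tendsto_intros) (auto simp: C0_plus_const_iff)
  then show ?thesis using assms by (auto simp: C0_def C0_plus_const_iff intro!: continuous_intros)
qed

text \<open>In this form only a \<open>C0\<close> function is integrated, so
  \<open>weak_star_conv\<close> applies; mass lost at infinity is accounted for by the
  constant.\<close>

lemma dual_value_alt:
  fixes \<psi> :: "'a::euclidean_space \<Rightarrow> real"
  assumes \<rho>: "\<rho> \<in> borel_subprobs" and \<psi>: "\<psi> \<in> C0_plus_const"
  shows "dual_value \<rho> \<psi> = (\<integral>x. \<psi> x - value_at_infinity \<psi> \<partial>\<rho>) + value_at_infinity \<psi>"
proof -
  interpret finite_measure \<rho> by (rule borel_subprobs_finite[OF \<rho>])
  have "(\<integral>x. \<psi> x - value_at_infinity \<psi> \<partial>\<rho>) = (\<integral>x. \<psi> x \<partial>\<rho>) - mass \<rho> * value_at_infinity \<psi>"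
    using C0_plus_const_integrable[OF assms] borel_subprobs_space[OF \<rho>] by (simp add: mass_def)
  then show ?thesis by (simp add: dual_value_def algebra_simps)
qed

lemma mass_borel_probs: "\<mu> \<in> borel_probs \<Longrightarrow> mass \<mu> = 1"
  using borel_subprobs_space borel_probs_subprobs prob_space.prob_space[of \<mu>]
  by (fastforce simp: mass_def borel_probs_def)

lemma admissible_le_coulomb_cost:
  assumes "\<psi> \<in> admissible N"
  shows "ennreal (1 / real N * (\<Sum>i\<in>{1..N}. \<psi> (x i))) \<le> coulomb_cost N x"
proof -
  have "e2ennreal (ereal (1 / real N * (\<Sum>i\<in>{1..N}. \<psi> (x i)))) \<le> e2ennreal (enn2ereal (coulomb_cost N x))"
    using assms by (intro e2ennreal_mono) (auto simp: admissible_def)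
  then show ?thesis by (simp only: e2ennreal_enn2ereal e2ennreal_ereal)
qed

text \<open>The constraint is integrated against a plan. Each coordinate has law \<mu>, so the mean
  of the N potentials has the same integral as \<psi> against \<mu>.\<close>

lemma admissible_le_transport_cost:
  fixes \<psi> :: "'a::euclidean_space \<Rightarrow> real"
  assumes N: "N \<ge> 1" and \<mu>: "\<mu> \<in> borel_probs" and \<psi>: "\<psi> \<in> admissible N"
  shows "ennreal (\<integral>x. \<psi> x \<partial>\<mu>) \<le> transport_cost N \<mu>"
  unfolding transport_cost_def
proof (rule INF_greatest)
  fix P assume P: "P \<in> transport_plans N \<mu>"
  then interpret P: prob_space P by (auto simp: transport_plans_def)
  have sets: "sets P = sets (Pi\<^sub>M {1..N} (\<lambda>_. borel))" using P by (auto simp: transport_plans_def)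
  have psi: "\<psi> \<in> C0_plus_const" using \<psi> by (auto simp: admissible_def)
  then obtain B where "B > 0" and B: "\<And>x. \<bar>\<psi> x\<bar> \<le> B"
    using C0_plus_const_bounded by blast
  have meas: "\<psi> \<in> borel_measurable borel"
    using psi by (intro borel_measurable_continuous_onI) (simp add: C0_plus_const_iff)
  have proj: "(\<lambda>x. x i) \<in> measurable P borel" if "i \<in> {1..N}" for i
    using measurable_component_singleton[OF that, of "\<lambda>_. borel"] by (simp add: measurable_cong_sets[OF sets refl])
  have int: "integrable P (\<lambda>x. \<psi> (x i))" if "i \<in> {1..N}" for i
    using measurable_compose[OF proj[OF that] meas] B by (intro P.integrable_const_bound[of _ B]) auto
  have eq: "(\<integral>x. \<psi> (x i) \<partial>P) = (\<integral>x. \<psi> x \<partial>\<mu>)" if "i \<in> {1..N}" for i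
    using integral_distr[OF proj[OF that] meas] P that by (auto simp: transport_plans_def)
  let ?f = "\<lambda>x. 1 / real N * (\<Sum>i\<in>{1..N}. \<psi> (x i))"
  have intf: "integrable P ?f" using int by (intro integrable_mult_right Bochner_Integration.integrable_sum) auto
  have "(\<integral>x. \<psi> x \<partial>\<mu>) = (\<integral>x. ?f x \<partial>P)"
    using N by (subst integral_mult_right_zero, subst Bochner_Integration.integral_sum) (auto simp: int eq)
  \<comment> \<open>The cost is integrated in \<open>ennreal\<close>, where negative numbers become
    0; hence the positive part.\<close>
  also have "\<dots> \<le> (\<integral>x. max 0 (?f x) \<partial>P)"
    using intf by (intro integral_mono integrable_max) auto
  finally have "ennreal (\<integral>x. \<psi> x \<partial>\<mu>) \<le> ennreal (\<integral>x. max 0 (?f x) \<partial>P)" by (rule ennreal_leI)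
  also have "\<dots> = (\<integral>\<^sup>+x. ennreal (max 0 (?f x)) \<partial>P)"
    using intf by (intro nn_integral_eq_integral[symmetric] integrable_max) auto
  also have "\<dots> \<le> (\<integral>\<^sup>+x. coulomb_cost N x \<partial>P)"
    using admissible_le_coulomb_cost[OF \<psi>] by (intro nn_integral_mono) (auto simp: max_def)
  finally show "ennreal (\<integral>x. \<psi> x \<partial>\<mu>) \<le> (\<integral>\<^sup>+x. coulomb_cost N x \<partial>P)" .
qed

text \<open>For a probability measure the dual value is just the integral of \<psi>, which lies
  below the transport cost. Dual values converge along weak* convergent sequences even if mass
  escapes to infinity.\<close>

lemma dual_value_le_relaxed_cost:
  fixes \<psi> :: "'a::euclidean_space \<Rightarrow> real"
  assumes N: "N \<ge> 1" and \<rho>: "\<rho> \<in> borel_subprobs" and \<psi>: "\<psi> \<in> admissible N"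
  shows "ennreal (dual_value \<rho> \<psi>) \<le> relaxed_cost N \<rho>"
  unfolding relaxed_cost_def
proof (rule Inf_greatest, clarify)
  fix \<rho>n :: "nat \<Rightarrow> 'a measure"
  assume \<rho>n: "\<forall>n. \<rho>n n \<in> borel_probs" and conv: "weak_star_conv \<rho>n \<rho>"
  have psi: "\<psi> \<in> C0_plus_const" using \<psi> by (auto simp: admissible_def)
  let ?v = "value_at_infinity \<psi>"
  have "(\<lambda>n. (\<integral>x. \<psi> x - ?v \<partial>\<rho>n n) + ?v) \<longlonglongrightarrow> (\<integral>x. \<psi> x - ?v \<partial>\<rho>) + ?v"
    using conv C0_plus_const_minus_value_at_infinity[OF psi]
    by (intro tendsto_intros) (auto simp: weak_star_conv_def)
  moreover have "(\<integral>x. \<psi> x - ?v \<partial>\<rho>n n) + ?v = (\<integral>x. \<psi> x \<partial>\<rho>n n)" for n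
  proof -
    have "\<rho>n n \<in> borel_probs" using \<rho>n by blast
    moreover from this have "\<rho>n n \<in> borel_subprobs" using borel_probs_subprobs by blast
    ultimately show ?thesis
      using dual_value_alt[OF _ psi, of "\<rho>n n"] by (simp add: dual_value_def mass_borel_probs)
  qed
  ultimately have "(\<lambda>n. \<integral>x. \<psi> x \<partial>\<rho>n n) \<longlonglongrightarrow> dual_value \<rho> \<psi>"
    by (simp add: dual_value_alt[OF \<rho> psi])
  then have "(\<lambda>n. ennreal (\<integral>x. \<psi> x \<partial>\<rho>n n)) \<longlonglongrightarrow> ennreal (dual_value \<rho> \<psi>)"
    by (rule tendsto_ennrealI)
  then have "ennreal (dual_value \<rho> \<psi>) = liminf (\<lambda>n. ennreal (\<integral>x. \<psi> x \<partial>\<rho>n n))"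
    by (intro lim_imp_Liminf[symmetric]) auto
  also have "\<dots> \<le> liminf (\<lambda>n. transport_cost N (\<rho>n n))"
    using admissible_le_transport_cost[OF N _ \<psi>] \<rho>n by (intro Liminf_mono always_eventually) auto
  finally show "ennreal (dual_value \<rho> \<psi>) \<le> liminf (\<lambda>n. transport_cost N (\<rho>n n))" .
qed

text \<open>With m the mass, 1 - (1 + \<delta>) m = (1 + \<delta>) (1 - m) - \<delta>, which
  accounts for the last term.\<close>

lemma dual_value_scale_measure:
  fixes \<psi> :: "'a::euclidean_space \<Rightarrow> real"
  assumes \<rho>: "\<rho> \<in> borel_subprobs" and \<psi>: "\<psi> \<in> C0_plus_const" and \<delta>: "\<delta> > 0"
  shows "dual_value (scale_measure (ennreal (1 + \<delta>)) \<rho>) \<psi>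
           = (1 + \<delta>) * dual_value \<rho> \<psi> - \<delta> * value_at_infinity \<psi>"
proof -
  have "\<psi> \<in> borel_measurable \<rho>" using C0_plus_const_integrable[OF \<rho> \<psi>] by auto
  then show ?thesis
    using \<delta> by (simp add: dual_value_def integral_scale_measure mass_def algebra_simps
        del: ennreal_plus)
qed

text \<open>Testing the dual problem for \<open>(1 + \<delta>) \<rho>\<close> with \<open>\<psi>\<close> penalizes negative values at infinity.\<close>

lemma dual_value_scale_bound:
  fixes \<psi> :: "'a::euclidean_space \<Rightarrow> real"
  assumes N: "N \<ge> 1" and \<rho>: "\<rho> \<in> borel_subprobs" and \<delta>: "\<delta> > 0"
    and \<rho>': "scale_measure (ennreal (1 + \<delta>)) \<rho> \<in> borel_subprobs"
    and fin: "relaxed_cost N (scale_measure (ennreal (1 + \<delta>)) \<rho>) < \<infinity>"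
    and \<psi>: "\<psi> \<in> admissible N"
  shows "(1 + \<delta>) * dual_value \<rho> \<psi> - \<delta> * value_at_infinity \<psi>
           \<le> enn2real (relaxed_cost N (scale_measure (ennreal (1 + \<delta>)) \<rho>))"
proof -
  let ?K = "relaxed_cost N (scale_measure (ennreal (1 + \<delta>)) \<rho>)"
  have "ennreal (dual_value (scale_measure (ennreal (1 + \<delta>)) \<rho>) \<psi>) \<le> ennreal (enn2real ?K)"
    using dual_value_le_relaxed_cost[OF N \<rho>' \<psi>] fin by (simp add: ennreal_enn2real_if less_top)
  then have "dual_value (scale_measure (ennreal (1 + \<delta>)) \<rho>) \<psi> \<le> enn2real ?K"
    by (simp add: ennreal_le_iff)
  then show ?thesis using dual_value_scale_measure[OF \<rho> _ \<delta>] \<psi> by (auto simp: admissible_def)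
qed

section \<open>Test functions for weak* convergence\<close>

text \<open>Finite maxima of cones with vertex q, height h and slope m, cut off at 0. With vertices
  in a countable dense set and rational heights they form a countable family.\<close>

fun cone_max :: "('a::real_normed_vector \<times> real \<times> nat) list \<Rightarrow> 'a \<Rightarrow> real" where
  "cone_max [] x = 0"
| "cone_max ((q, h, m) # l) x = max (h - real m * norm (x - q)) (cone_max l x)"

lemma cone_max_nonneg: "0 \<le> cone_max l x"
  by (induction l) auto

lemma cone_max_le:
  assumes "0 \<le> b" "\<And>q h m. (q, h, m) \<in> set l \<Longrightarrow> h - real m * norm (x - q) \<le> b"
  shows "cone_max l x \<le> b"
  using assms by (induction l) auto

lemma cone_max_ge: "(q, h, m) \<in> set l \<Longrightarrow> h - real m * norm (x - q) \<le> cone_max l x"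
  by (induction l) auto

lemma cone_max_C0:
  fixes l :: "('a::euclidean_space \<times> real \<times> nat) list"
  assumes "\<And>q h m. (q, h, m) \<in> set l \<Longrightarrow> m \<ge> 1"
  shows "cone_max l \<in> C0"
  using assms
proof (induction l)
  case Nil
  have "cone_max [] = (\<lambda>_::'a. 0)" by (rule ext) simp
  then show ?case by (simp add: C0_def)
next
  case (Cons t l)
  obtain q h m where t: "t = (q, h, m)" by (cases t)
  have m: "m \<ge> 1" using Cons.prems[of q h m] t by simp
  have IH: "cone_max l \<in> C0" using Cons by force
  have eq: "cone_max (t # l) = (\<lambda>x. max (h - real m * norm (x - q)) (cone_max l x))"
    by (rule ext) (simp add: t)
  \<comment> \<open>Outside this ball the new cone is nonpositive, as its slope is at least 1, and
    the maximum ignores it.\<close>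
  have "eventually (\<lambda>x::'a. norm x \<ge> norm q + \<bar>h\<bar>) at_infinity"
    by (auto simp: eventually_at_infinity)
  then have "eventually (\<lambda>x. cone_max l x = cone_max (t # l) x) at_infinity"
  proof eventually_elim
    case (elim x)
    have "\<bar>h\<bar> \<le> norm (x - q)" using elim norm_triangle_ineq2[of x q] by simp
    also have "\<dots> \<le> real m * norm (x - q)" using m by (simp add: mult_le_cancel_right1)
    finally have "h - real m * norm (x - q) \<le> 0" by simp
    then show ?case using cone_max_nonneg[of l x] by (simp add: t)
  qed
  then have "(cone_max (t # l) \<longlongrightarrow> 0) at_infinity"
    by (rule Lim_transform_eventually[rotated]) (use IH in \<open>auto simp: C0_def\<close>)
  moreover have "continuous_on UNIV (cone_max (t # l))"
    unfolding eq using IH by (intro continuous_intros) (auto simp: C0_def)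
  ultimately show ?case by (simp add: C0_def)
qed

text \<open>A cone of height at most 1 is positive only within 1 / m of q, and for steep cones this
  ball lies where f exceeds h by continuity at p. At p the height loses less than e / 2 and the
  offset of q less than e / 4.\<close>

lemma cone_below:
  fixes f :: "'a::euclidean_space \<Rightarrow> real"
  assumes f: "continuous_on UNIV f" "\<And>x. 0 \<le> f x" "\<And>x. f x \<le> 1"
    and D: "\<And>x::'a. \<And>e. e > 0 \<Longrightarrow> \<exists>q\<in>D. dist q x < e"
    and e: "e > 0" "e \<le> f p"
  obtains q h m where "q \<in> D" "h \<in> \<rat>" "0 \<le> h" "h \<le> 1" "m \<ge> 1"
    "\<And>x. h - real m * norm (x - q) \<le> f x" "f p - e < h - real m * norm (p - q)"
proof -
  obtain d where d: "d > 0" "\<And>x. dist x p < d \<Longrightarrow> dist (f x) (f p) < e / 4"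
    using f(1) e by (force simp: continuous_on_iff dest: bspec[of _ _ p] spec[of _ "e / 4"])
  obtain m' where m': "inverse (real (Suc m')) < d / 2" using d(1) reals_Archimedean[of "d/2"] by auto
  define m where "m = Suc m'"
  have m: "m \<ge> 1" "1 / real m < d / 2" using m' by (auto simp: m_def inverse_eq_divide)
  obtain h where h: "h \<in> \<rat>" "f p - e / 2 < h" "h < f p - e / 4"
    using Rats_dense_in_real[of "f p - e / 2" "f p - e / 4"] e by auto
  have h01: "0 \<le> h" "h \<le> 1" using h e f(3)[of p] by auto
  obtain q where q: "q \<in> D" "dist q p < min (d / 2) (e / (4 * real m))"
    using D[of "min (d / 2) (e / (4 * real m))" p] d(1) e m by auto
  show ?thesis
  proof (rule that[OF q(1) h(1) h01 m(1)])
    fix x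
    show "h - real m * norm (x - q) \<le> f x"
    proof (cases "h - real m * norm (x - q) \<le> 0")
      case True
      then show ?thesis using f(2)[of x] by linarith
    next
      case False
      then have "norm (x - q) * real m < 1" using h01 by (simp add: mult.commute)
      then have "norm (x - q) < 1 / real m" using m(1) by (simp add: pos_less_divide_eq)
      then have "dist x q < d / 2" using m(2) by (simp add: dist_norm)
      moreover have "dist q p < d / 2" using q by simp
      ultimately have "dist x p < d" using dist_triangle[of x p q] by linarith
      then have "f p - e / 4 < f x" using d(2)[of x] unfolding dist_real_def by linarith
      moreover have "h - real m * norm (x - q) \<le> h" by simp
      ultimately show ?thesis using h by linarith
    qed
  next
    have "norm (p - q) < e / (4 * real m)" using q by (simp add: dist_norm norm_minus_commute)
    then have "real m * norm (p - q) < e / 4" using m(1) by (simp add: field_simps)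
    then show "f p - e < h - real m * norm (p - q)" using h e by linarith
  qed
qed

text \<open>Cones below f never overshoot. By compactness finitely many of them come within e of f
  where f \<ge> e, and elsewhere the value 0 is already close enough.\<close>

lemma cone_max_dense:
  fixes f :: "'a::euclidean_space \<Rightarrow> real"
  assumes f: "f \<in> C0" "\<And>x. 0 \<le> f x" "\<And>x. f x \<le> 1"
    and D: "\<And>x::'a. \<And>e. e > 0 \<Longrightarrow> \<exists>q\<in>D. dist q x < e"
    and e: "e > 0"
  obtains l where "l \<in> lists (D \<times> (\<rat> \<inter> {0..1}) \<times> {1..})" "\<And>x. \<bar>f x - cone_max l x\<bar> \<le> e"
proof -
  have cont: "continuous_on UNIV f" and lim: "(f \<longlongrightarrow> 0) at_infinity" using f(1) by (auto simp: C0_def)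
  define K where "K = {x. e \<le> f x}"
  define I where "I = {(q, h, m) \<in> D \<times> (\<rat> \<inter> {0..1}) \<times> {1..}. \<forall>x. h - real m * norm (x - q) \<le> f x}"
  define U where "U = (\<lambda>(q, h, m::nat). {x::'a. f x - e < h - real m * norm (x - q)})"
  have "eventually (\<lambda>x. f x < e) at_infinity" using lim e by (rule order_tendstoD)
  then obtain b where b: "\<And>x. b \<le> norm x \<Longrightarrow> f x < e" by (auto simp: eventually_at_infinity)
  have "norm x \<le> b" if "e \<le> f x" for x using b[of x] that by linarith
  then have "bounded K" unfolding bounded_iff K_def by blast
  moreover have "closed K" unfolding K_def by (intro closed_Collect_le continuous_intros cont)
  ultimately have K: "compact K" by (simp add: compact_eq_bounded_closed)
  have "K \<subseteq> (\<Union>t\<in>I. U t)"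
  proof
    fix p assume "p \<in> K"
    then have "e \<le> f p" by (simp add: K_def)
    then obtain q h m where "q \<in> D" "h \<in> \<rat>" "0 \<le> h" "h \<le> 1" "m \<ge> 1"
      "\<And>x. h - real m * norm (x - q) \<le> f x" "f p - e < h - real m * norm (p - q)"
      using cone_below[OF cont f(2,3) D e] by metis
    then show "p \<in> (\<Union>t\<in>I. U t)" by (intro UN_I[of "(q, h, m)"]) (auto simp: I_def U_def)
  qed
  moreover have "open (U t)" for t
    by (cases t) (auto simp: U_def intro!: open_Collect_less continuous_intros cont)
  ultimately obtain T where T: "T \<subseteq> I" "finite T" "K \<subseteq> (\<Union>t\<in>T. U t)"
    using compactE_image[OF K, of I U] by metis
  obtain l where l: "set l = T" using finite_list[OF T(2)] by blast
  show ?thesis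
  proof (rule that[of l])
    show "l \<in> lists (D \<times> (\<rat> \<inter> {0..1}) \<times> {1..})" using l T(1) by (auto simp: I_def)
    fix x
    have le: "cone_max l x \<le> f x" using l T(1) by (intro cone_max_le f) (auto simp: I_def)
    have "f x - e \<le> cone_max l x"
    proof (cases "x \<in> K")
      case True
      then obtain q h m where "(q, h, m) \<in> T" "f x - e < h - real m * norm (x - q)"
        using T(3) by (auto simp: U_def)
      then show ?thesis using cone_max_ge[of q h m l x] l by simp
    next
      case False
      then show ?thesis using cone_max_nonneg[of l x] by (simp add: K_def)
    qed
    then show "\<bar>f x - cone_max l x\<bar> \<le> e" using le by simp
  qed
qed

lemma C0_integrable:
  fixes \<phi> :: "'a::euclidean_space \<Rightarrow> real"
  assumes "\<rho> \<in> borel_subprobs" "\<phi> \<in> C0"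
  shows "integrable \<rho> \<phi>"
  using C0_plus_const_integrable[OF assms(1)] C0_subset_C0_plus_const assms(2) by blast

lemma integral_diff_le_of_uniform:
  fixes f g :: "'a::euclidean_space \<Rightarrow> real"
  assumes \<rho>: "\<rho> \<in> borel_subprobs" and "f \<in> C0" "g \<in> C0" and le: "\<And>x. \<bar>f x - g x\<bar> \<le> e"
  shows "\<bar>(\<integral>x. f x \<partial>\<rho>) - (\<integral>x. g x \<partial>\<rho>)\<bar> \<le> e"
proof -
  interpret finite_measure \<rho> by (rule borel_subprobs_finite[OF \<rho>])
  have int: "integrable \<rho> f" "integrable \<rho> g" using assms C0_integrable by blast+
  have "e \<ge> 0" using le[of undefined] by linarith
  have "\<bar>(\<integral>x. f x \<partial>\<rho>) - (\<integral>x. g x \<partial>\<rho>)\<bar> = \<bar>\<integral>x. f x - g x \<partial>\<rho>\<bar>"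
    using int by simp
  also have "\<dots> \<le> (\<integral>x. \<bar>f x - g x\<bar> \<partial>\<rho>)" by (rule integral_abs_bound)
  also have "\<dots> \<le> (\<integral>x. e \<partial>\<rho>)" using int le by (intro integral_mono) auto
  also have "\<dots> = e * measure \<rho> UNIV" using borel_subprobs_space[OF \<rho>] by simp
  also have "measure \<rho> UNIV \<le> 1"
    using \<rho> by (auto simp: borel_subprobs_def measure_def intro!: enn2real_leI)
  then have "e * measure \<rho> UNIV \<le> e" using \<open>e \<ge> 0\<close> by (simp add: mult_left_le)
  finally show ?thesis .
qed

text \<open>All masses are at most 1, so uniform approximation by cone maxima passes to the
  integrals. A general function in \<open>C0\<close> is a multiple of a difference of two such
  functions with values in [0, 1].\<close>

lemma weak_star_test_functions:
  obtains \<phi> :: "nat \<Rightarrow> 'a::euclidean_space \<Rightarrow> real"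
  where "\<And>k. \<phi> k \<in> C0" "\<And>k x. 0 \<le> \<phi> k x" "\<And>k x. \<phi> k x \<le> 1"
    "\<forall>\<mu> \<rho>. (\<forall>n. \<mu> n \<in> borel_probs) \<longrightarrow> \<rho> \<in> borel_subprobs \<longrightarrow>
        (\<forall>k. (\<lambda>n. \<integral>x. \<phi> k x \<partial>\<mu> n) \<longlonglongrightarrow> (\<integral>x. \<phi> k x \<partial>\<rho>)) \<longrightarrow> weak_star_conv \<mu> \<rho>"
proof -
  obtain D :: "'a set" where cD: "countable D" and D0: "\<And>X. open X \<Longrightarrow> X \<noteq> {} \<Longrightarrow> \<exists>d\<in>D. d \<in> X"
    using countable_dense_setE by metis
  have D: "\<exists>q\<in>D. dist q x < e" if "e > 0" for x :: 'a and e
    using D0[of "ball x e"] that by (auto simp: dist_commute)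
  define I where "I = lists (D \<times> (\<rat> \<inter> {0..1::real}) \<times> {1::nat..})"
  have "countable I" unfolding I_def using cD by (intro countable_lists countable_SIGMA) (auto intro: countable_subset[OF _ countable_rat])
  moreover have "I \<noteq> {}" unfolding I_def by (auto intro!: exI[of _ "[]"])
  ultimately have range: "range (from_nat_into I) = I" by (rule range_from_nat_into[rotated])
  define \<phi> where "\<phi> k = cone_max (from_nat_into I k)" for k
  have Ik: "from_nat_into I k \<in> I" for k using range by blast
  have 1: "\<phi> k \<in> C0" for k
    unfolding \<phi>_def using Ik[of k] by (intro cone_max_C0) (auto simp: I_def)
  have 2: "0 \<le> \<phi> k x" for k x unfolding \<phi>_def by (rule cone_max_nonneg)
  have 3: "\<phi> k x \<le> 1" for k x
    unfolding \<phi>_def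
  proof (rule cone_max_le)
    fix q h m assume "(q, h, m) \<in> set (from_nat_into I k)"
    then have "h \<le> 1" using Ik[of k] by (auto simp: I_def)
    then show "h - real m * norm (x - q) \<le> 1" by (smt (verit) mult_nonneg_nonneg norm_ge_zero of_nat_0_le_iff)
  qed simp
  show ?thesis
  proof (rule that[OF 1 2 3], intro allI impI)
    fix \<mu> :: "nat \<Rightarrow> 'a measure" and \<rho> :: "'a measure"
    assume "\<forall>n. \<mu> n \<in> borel_probs" and \<rho>: "\<rho> \<in> borel_subprobs"
      and conv: "\<forall>k. (\<lambda>n. \<integral>x. \<phi> k x \<partial>\<mu> n) \<longlonglongrightarrow> (\<integral>x. \<phi> k x \<partial>\<rho>)"
    have \<mu>: "\<mu> n \<in> borel_subprobs" for n
      using \<open>\<forall>n. \<mu> n \<in> borel_probs\<close> borel_probs_subprobs by blast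
    have unit: "(\<lambda>n. \<integral>x. f x \<partial>\<mu> n) \<longlonglongrightarrow> (\<integral>x. f x \<partial>\<rho>)"
      if f: "f \<in> C0" "\<And>x. 0 \<le> f x" "\<And>x. f x \<le> 1" for f
    proof (rule tendstoI)
      fix e :: real assume e: "e > 0"
      obtain l where l: "l \<in> I" "\<And>x. \<bar>f x - cone_max l x\<bar> \<le> e / 3"
        using cone_max_dense[OF f D, of "e / 3"] e unfolding I_def by auto
      obtain k where "l = from_nat_into I k" using range l(1) by (metis rangeE)
      then have k: "\<And>x. \<bar>f x - \<phi> k x\<bar> \<le> e / 3" using l(2) by (simp add: \<phi>_def)
      have "eventually (\<lambda>n. dist (\<integral>x. \<phi> k x \<partial>\<mu> n) (\<integral>x. \<phi> k x \<partial>\<rho>) < e / 3) sequentially"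
        using conv[rule_format, of k] e by (intro tendstoD) auto
      then show "eventually (\<lambda>n. dist (\<integral>x. f x \<partial>\<mu> n) (\<integral>x. f x \<partial>\<rho>) < e) sequentially"
      proof eventually_elim
        case (elim n)
        then show ?case
          using integral_diff_le_of_uniform[OF \<mu> f(1) 1 k, of n] integral_diff_le_of_uniform[OF \<rho> f(1) 1 k]
          unfolding dist_real_def by linarith
      qed
    qed
    show "weak_star_conv \<mu> \<rho>"
      unfolding weak_star_conv_def
    proof
      fix f :: "'a \<Rightarrow> real" assume f: "f \<in> C0"
      obtain B where B: "B > 0" "\<And>x. \<bar>f x\<bar> \<le> B"
        using f C0_subset_C0_plus_const C0_plus_const_bounded[of f] by blast
      have part: "(\<lambda>x. max 0 (s * f x / B)) \<in> C0" for s
      proof -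
        have "((\<lambda>x. max 0 (s * f x / B)) \<longlongrightarrow> max 0 (s * 0 / B)) at_infinity"
          using f B(1) by (intro tendsto_intros) (auto simp: C0_def)
        then show ?thesis using f B(1) by (auto simp: C0_def intro!: continuous_intros)
      qed
      have le1: "max 0 (s * f x / B) \<le> 1" if "s \<in> {1, -1}" for s x
        using B(1) B(2)[of x] that by (auto simp: abs_le_iff)
      let ?g = "\<lambda>s x. max 0 (s * f x / B)"
      have int: "(\<integral>x. f x \<partial>M) = B * (\<integral>x. ?g 1 x \<partial>M) - B * (\<integral>x. ?g (-1) x \<partial>M)"
        if "M \<in> borel_subprobs" for M
      proof -
        have "f x = B * ?g 1 x - B * ?g (-1) x" for x
          using B(1) by (auto simp: max_def field_simps)
        then have "(\<integral>x. f x \<partial>M) = (\<integral>x. B * ?g 1 x - B * ?g (-1) x \<partial>M)" by simp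
        also have "\<dots> = B * (\<integral>x. ?g 1 x \<partial>M) - B * (\<integral>x. ?g (-1) x \<partial>M)"
          by (simp only: Bochner_Integration.integral_diff integrable_mult_right
              integral_mult_right_zero C0_integrable[OF that part])
        finally show ?thesis .
      qed
      have "(\<lambda>n. B * (\<integral>x. ?g 1 x \<partial>\<mu> n) - B * (\<integral>x. ?g (-1) x \<partial>\<mu> n))
          \<longlonglongrightarrow> B * (\<integral>x. ?g 1 x \<partial>\<rho>) - B * (\<integral>x. ?g (-1) x \<partial>\<rho>)"
        by (intro tendsto_intros unit part le1) auto
      then show "(\<lambda>n. \<integral>x. f x \<partial>\<mu> n) \<longlonglongrightarrow> (\<integral>x. f x \<partial>\<rho>)"
        by (simp only: int[OF \<mu>] int[OF \<rho>])
    qed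
  qed
qed

section \<open>Strong duality\<close>

lemma coulomb_cost_alt:
  "coulomb_cost N x =
     (\<Sum>i\<in>{1..N}. \<Sum>j\<in>{1..N}. if i < j then 1 / ennreal (norm (x i - x j)) else 0)"
  unfolding coulomb_cost_def
proof (rule sum.cong[OF refl])
  fix i assume "i \<in> {1..N}"
  have "(\<Sum>j\<in>{1..N}. if i < j then 1 / ennreal (norm (x i - x j)) else 0)
      = (\<Sum>j\<in>{j \<in> {1..N}. i < j}. 1 / ennreal (norm (x i - x j)))"
    by (subst sum.inter_filter) auto
  also have "{j \<in> {1..N}. i < j} = {i<..N}" using \<open>i \<in> {1..N}\<close> by auto
  finally show "(\<Sum>j\<in>{i<..N}. 1 / ennreal (norm (x i - x j)))
      = (\<Sum>j\<in>{1..N}. if i < j then 1 / ennreal (norm (x i - x j)) else 0)" by simp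
qed

text \<open>A permutation of the indices preserves i \<noteq> j but not i < j; hence the detour
  through ordered pairs.\<close>

lemma coulomb_cost_double:
  "coulomb_cost N x + coulomb_cost N x =
     (\<Sum>i\<in>{1..N}. \<Sum>j\<in>{1..N}. if i \<noteq> j then 1 / ennreal (norm (x i - x j)) else 0)"
proof -
  let ?g = "\<lambda>i j. 1 / ennreal (norm (x i - x j))"
  have "(\<Sum>i\<in>{1..N}. \<Sum>j\<in>{1..N}. if i < j then ?g i j else 0)
      = (\<Sum>j\<in>{1..N}. \<Sum>i\<in>{1..N}. if i < j then ?g i j else 0)"
    by (rule sum.swap)
  also have "\<dots> = (\<Sum>i\<in>{1..N}. \<Sum>j\<in>{1..N}. if j < i then ?g i j else 0)"
    by (intro sum.cong refl) (auto simp: norm_minus_commute)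
  finally have swap: "coulomb_cost N x = (\<Sum>i\<in>{1..N}. \<Sum>j\<in>{1..N}. if j < i then ?g i j else 0)"
    by (simp only: coulomb_cost_alt)
  have "coulomb_cost N x + coulomb_cost N x =
      (\<Sum>i\<in>{1..N}. \<Sum>j\<in>{1..N}. (if i < j then ?g i j else 0) + (if j < i then ?g i j else 0))"
    by (subst swap, subst coulomb_cost_alt) (simp only: sum.distrib)
  also have "\<dots> = (\<Sum>i\<in>{1..N}. \<Sum>j\<in>{1..N}. if i \<noteq> j then ?g i j else 0)"
    by (intro sum.cong refl) auto
  finally show ?thesis .
qed

lemma coulomb_cost_permute:
  assumes "bij_betw \<sigma> {1..N} {1..N}"
  shows "coulomb_cost N (\<lambda>i. x (\<sigma> i)) = coulomb_cost N x"
proof -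
  let ?h = "\<lambda>i j. if i \<noteq> j then 1 / ennreal (norm (x i - x j)) else 0"
  have "(\<Sum>i\<in>{1..N}. \<Sum>j\<in>{1..N}. if i \<noteq> j then 1 / ennreal (norm (x (\<sigma> i) - x (\<sigma> j))) else 0)
      = (\<Sum>i\<in>{1..N}. \<Sum>j\<in>{1..N}. ?h (\<sigma> i) (\<sigma> j))"
    using bij_betw_imp_inj_on[OF assms] by (intro sum.cong refl) (auto simp: inj_on_eq_iff)
  also have "\<dots> = (\<Sum>i\<in>{1..N}. \<Sum>j\<in>{1..N}. ?h (\<sigma> i) j)"
    by (intro sum.cong refl sum.reindex_bij_betw[OF assms])
  also have "\<dots> = (\<Sum>i\<in>{1..N}. \<Sum>j\<in>{1..N}. ?h i j)"
    by (rule sum.reindex_bij_betw[OF assms, of "\<lambda>i. \<Sum>j\<in>{1..N}. ?h i j"])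
  finally have "2 * coulomb_cost N (\<lambda>i. x (\<sigma> i)) = 2 * coulomb_cost N x"
    using coulomb_cost_double[of N "\<lambda>i. x (\<sigma> i)"] coulomb_cost_double[of N x] by (simp only: mult_2)
  \<comment> \<open>The factor 2 is neither 0 nor infinite, so it cancels even when the cost is
    infinite.\<close>
  then show ?thesis by (simp add: ennreal_mult_cancel_left)
qed

lemma coulomb_cost_cong: "(\<And>i. i \<in> {1..N} \<Longrightarrow> x i = y i) \<Longrightarrow> coulomb_cost N x = coulomb_cost N y"
  unfolding coulomb_cost_alt by (intro sum.cong refl) auto

lemma coulomb_cost_measurable [measurable]:
  "coulomb_cost N \<in> borel_measurable (Pi\<^sub>M {1..N} (\<lambda>_. borel :: 'a::euclidean_space measure))"
proof -
  have 1: "(\<lambda>x. x i - x j) \<in> borel_measurable (Pi\<^sub>M {1..N} (\<lambda>_. borel :: 'a measure))"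
    if "i \<in> {1..N}" "j \<in> {i<..N}" for i j
    using that by (intro borel_measurable_diff measurable_component_singleton) auto
  have 2: "(\<lambda>x. norm (x i - x j)) \<in> borel_measurable (Pi\<^sub>M {1..N} (\<lambda>_. borel :: 'a measure))"
    if "i \<in> {1..N}" "j \<in> {i<..N}" for i j
  proof -
    note [measurable] = 1[OF that]
    show ?thesis by measurable
  qed
  show ?thesis
    unfolding coulomb_cost_def[abs_def]
    by (intro borel_measurable_sum borel_measurable_divide_ennreal borel_measurable_const
        measurable_compose[OF _ measurable_ennreal] 2)
qed

section \<open>Symmetrization of finitely supported plans\<close>

definition cyclic_shift :: "nat \<Rightarrow> nat \<Rightarrow> nat \<Rightarrow> nat" where
  "cyclic_shift N k i = (i + k) mod N + 1"

text \<open>The added 1 moves residues into {1..N}, so \<open>k\<close> stands for a rotation by k +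
  1. Bijectivity in k lets a random shift hit all coordinates equally often; bijectivity in i makes
  each shift a permutation, which preserves the cost.\<close>

lemma cyclic_shift_bij:
  assumes "N \<ge> 1"
  shows "bij_betw (\<lambda>k. cyclic_shift N k i) {0..<N} {1..N}" "bij_betw (cyclic_shift N k) {1..N} {1..N}"
proof -
  have mod_inj: "a = b" if "(a + c) mod N = (b + c) mod N" "\<bar>int a - int b\<bar> < int N" for a b c
  proof -
    have "int N dvd (int (a + c) - int (b + c))"
      using that(1) by (metis mod_eq_dvd_iff zmod_int)
    then have "int N dvd (int a - int b)" by simp
    then show ?thesis using that(2) by (metis dvd_imp_le_int eq_iff_diff_eq_0 int_int_eq not_less abs_of_nat)
  qed
  have inj1: "inj_on (\<lambda>k. cyclic_shift N k i) {0..<N}"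
    by (rule inj_onI) (auto simp: cyclic_shift_def add.commute[of i] intro!: mod_inj[of _ i])
  have inj2: "inj_on (cyclic_shift N k) {1..N}"
    by (rule inj_onI) (auto simp: cyclic_shift_def intro!: mod_inj[of _ k])
  have sub: "cyclic_shift N k i \<in> {1..N}" for k i
    using assms by (auto simp: cyclic_shift_def Suc_le_eq)
  show "bij_betw (\<lambda>k. cyclic_shift N k i) {0..<N} {1..N}"
    unfolding bij_betw_def using inj1 sub
    by (intro conjI card_subset_eq) (auto simp: card_image)
  show "bij_betw (cyclic_shift N k) {1..N} {1..N}"
    unfolding bij_betw_def using inj2 sub
    by (intro conjI card_subset_eq) (auto simp: card_image)
qed

text \<open>The coordinates of a plan \<open>q\<close> may have different laws; their mean is the
  common marginal after symmetrization.\<close>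

definition averaged_marginal :: "nat \<Rightarrow> (nat \<Rightarrow> 'a) pmf \<Rightarrow> 'a pmf" where
  "averaged_marginal N q = pmf_of_set {1..N} \<bind> (\<lambda>i. map_pmf (\<lambda>x. x i) q)"

text \<open>A \<open>pmf\<close> carries the discrete sigma-algebra; this moves it to the Borel
  sets.\<close>

definition borel_of_pmf :: "'a::topological_space pmf \<Rightarrow> 'a measure" where
  "borel_of_pmf p = distr (measure_pmf p) borel (\<lambda>x. x)"

lemma borel_of_pmf_borel_probs: "borel_of_pmf p \<in> borel_probs"
  by (auto simp: borel_probs_def borel_of_pmf_def intro!: prob_space.prob_space_distr measure_pmf.prob_space_axioms)

text \<open>Averaging a plan over the cyclic shifts of the coordinates equalizes its marginals and
  preserves its cost.\<close>

lemma transport_cost_averaged_marginal_le: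
  fixes q :: "(nat \<Rightarrow> 'a::euclidean_space) pmf"
  assumes N: "N \<ge> 1"
  shows "transport_cost N (borel_of_pmf (averaged_marginal N q)) \<le> (\<integral>\<^sup>+x. coulomb_cost N x \<partial>measure_pmf q)"
proof -
  define Q where "Q = pmf_of_set {0..<N} \<bind> (\<lambda>k. map_pmf (\<lambda>x i. x (cyclic_shift N k i)) q)"
  \<comment> \<open>Points of the product space are \<open>undefined\<close> outside {1..N}, so the
    other coordinates have to be discarded.\<close>
  define P where "P = distr (measure_pmf Q) (Pi\<^sub>M {1..N} (\<lambda>_. borel)) (\<lambda>x. restrict x {1..N})"
  have meas: "(\<lambda>x. restrict x {1..N}) \<in> measurable (measure_pmf Q) (Pi\<^sub>M {1..N} (\<lambda>_. borel :: 'a measure))"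
    by (auto simp: space_PiM)
  have marg: "map_pmf (\<lambda>x. x i) Q = averaged_marginal N q" for i
  proof -
    have "map_pmf (\<lambda>x. x i) Q
        = map_pmf (\<lambda>k. cyclic_shift N k i) (pmf_of_set {0..<N}) \<bind> (\<lambda>j. map_pmf (\<lambda>x. x j) q)"
      by (simp add: Q_def map_bind_pmf bind_map_pmf map_pmf_comp)
    also have "map_pmf (\<lambda>k. cyclic_shift N k i) (pmf_of_set {0..<N}) = pmf_of_set {1..N}"
      using N by (intro map_pmf_of_set_bij_betw cyclic_shift_bij) auto
    finally show ?thesis by (simp add: averaged_marginal_def)
  qed
  have "distr P borel (\<lambda>x. x i) = borel_of_pmf (averaged_marginal N q)" if i: "i \<in> {1..N}" for i
  proof -
    have "distr P borel (\<lambda>x. x i) = distr (measure_pmf Q) borel (\<lambda>x. x i)"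
      unfolding P_def
      by (subst distr_distr[OF measurable_component_singleton[OF i] meas]) (use i in \<open>auto simp: o_def intro!: distr_cong\<close>)
    also have "\<dots> = distr (measure_pmf (map_pmf (\<lambda>x. x i) Q)) borel (\<lambda>x. x)"
      by (simp add: map_pmf_rep_eq distr_distr o_def)
    finally show ?thesis by (simp add: marg borel_of_pmf_def)
  qed
  moreover have "prob_space P"
    unfolding P_def by (intro prob_space.prob_space_distr measure_pmf.prob_space_axioms meas)
  ultimately have P: "P \<in> transport_plans N (borel_of_pmf (averaged_marginal N q))"
    by (auto simp: transport_plans_def P_def)
  have "(\<integral>\<^sup>+x. coulomb_cost N x \<partial>P) = (\<integral>\<^sup>+x. coulomb_cost N x \<partial>measure_pmf Q)"
    unfolding P_def 
    by (subst nn_integral_distr[OF meas], subst measurable_distr_eq1, rule coulomb_cost_measurable)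
       (auto intro!: nn_integral_cong coulomb_cost_cong)
  also have "\<dots> = (\<integral>\<^sup>+k. \<integral>\<^sup>+x. coulomb_cost N x \<partial>measure_pmf q \<partial>measure_pmf (pmf_of_set {0..<N}))"
    unfolding Q_def by (simp add: coulomb_cost_permute[OF cyclic_shift_bij(2)[OF N]])
  also have "\<dots> = (\<integral>\<^sup>+x. coulomb_cost N x \<partial>measure_pmf q)" by simp
  finally show ?thesis unfolding transport_cost_def using P by (intro INF_lower2[of P]) auto
qed

lemma integral_averaged_marginal:
  fixes f :: "'a::topological_space \<Rightarrow> real"
  assumes N: "N \<ge> 1" and q: "finite (set_pmf q)" and f: "f \<in> borel_measurable borel"
  shows "(\<integral>x. f x \<partial>borel_of_pmf (averaged_marginal N q))
           = measure_pmf.expectation q (\<lambda>x. 1 / real N * (\<Sum>i\<in>{1..N}. f (x i)))"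
proof -
  have int: "integrable (measure_pmf q) g" for g :: "_ \<Rightarrow> real"
    using q by (rule integrable_measure_pmf_finite)
  have "(\<integral>x. f x \<partial>borel_of_pmf (averaged_marginal N q)) = measure_pmf.expectation (averaged_marginal N q) f"
    unfolding borel_of_pmf_def using f by (subst integral_distr) auto
  also have "\<dots> = (\<Sum>i\<in>{1..N}. measure_pmf.expectation q (\<lambda>x. f (x i)) /\<^sub>R real (card {1..N}))"
    unfolding averaged_marginal_def using N q by (subst pmf_expectation_bind_pmf_of_set) auto
  also have "\<dots> = 1 / real N * (\<Sum>i\<in>{1..N}. measure_pmf.expectation q (\<lambda>x. f (x i)))"
    by (simp add: sum_distrib_left inverse_eq_divide)
  also have "\<dots> = measure_pmf.expectation q (\<lambda>x. 1 / real N * (\<Sum>i\<in>{1..N}. f (x i)))"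
    by (simp add: int)
  finally show ?thesis .
qed

text \<open>Its expectation under a plan \<open>q\<close> is the integral of \<open>f\<close>
  against the averaged marginal of \<open>q\<close>; for a potential it is the left-hand side of the
  dual constraint.\<close>

definition mean_test :: "nat \<Rightarrow> ('a \<Rightarrow> real) \<Rightarrow> (nat \<Rightarrow> 'a) \<Rightarrow> real" where
  "mean_test N f x = 1 / real N * (\<Sum>i\<in>{1..N}. f (x i))"

text \<open>Distinct integer multiples of a unit vector are at distance at least 1. This provides a
  competitor in the penalized problem.\<close>

lemma coulomb_cost_finite_point:
  obtains x :: "nat \<Rightarrow> 'a::euclidean_space" where "coulomb_cost N x < \<infinity>"
proof -
  obtain b :: 'a where b: "b \<in> Basis" using nonempty_Basis by blast
  have "coulomb_cost N (\<lambda>i. real i *\<^sub>R b) = ennreal (trunc_cost N 1 (\<lambda>i. Some (real i *\<^sub>R b)))"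
    using b by (intro coulomb_cost_eq_trunc_cost) (auto simp flip: scaleR_diff_left)
  then show ?thesis using that by (metis ennreal_less_top infinity_ennreal_def)
qed

lemma C0_sum:
  fixes \<phi> :: "nat \<Rightarrow> 'a::euclidean_space \<Rightarrow> real"
  assumes "\<And>k. \<phi> k \<in> C0"
  shows "(\<lambda>x. \<Sum>k<n. c k * \<phi> k x) \<in> C0"
proof -
  have "((\<lambda>x. \<Sum>k<n. c k * \<phi> k x) \<longlongrightarrow> (\<Sum>k<n. c k * 0)) at_infinity"
    using assms by (intro tendsto_intros) (auto simp: C0_def)
  then show ?thesis using assms by (auto simp: C0_def intro!: continuous_intros)
qed

text \<open>Points of infinite cost satisfy the constraint trivially; setting them aside matters
  because \<open>enn2real\<close> sends \<open>top\<close> to 0.\<close>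

lemma admissibleI:
  fixes \<psi> :: "'a::euclidean_space \<Rightarrow> real"
  assumes "\<psi> \<in> C0_plus_const"
    and "\<And>x. coulomb_cost N x < \<infinity> \<Longrightarrow> mean_test N \<psi> x \<le> enn2real (coulomb_cost N x)"
  shows "\<psi> \<in> admissible N"
proof -
  have "ereal (mean_test N \<psi> x) \<le> enn2ereal (coulomb_cost N x)" for x :: "nat \<Rightarrow> 'a"
  proof (cases "coulomb_cost N x < \<infinity>")
    case True
    then have "coulomb_cost N x = ennreal (enn2real (coulomb_cost N x))" by (simp add: less_top)
    then have "enn2ereal (coulomb_cost N x) = ereal (enn2real (coulomb_cost N x))"
      by (metis enn2ereal_ennreal enn2real_nonneg)
    then show ?thesis using assms(2)[OF True] by simp
  next
    case False
    then have "coulomb_cost N x = top" by (simp add: not_less top_unique)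
    then show ?thesis by simp
  qed
  then show ?thesis using assms(1) by (simp add: admissible_def mean_test_def)
qed

text \<open>Minimize the cost plus \<open>n\<close> times the squared defects of the first \<open>n\<close> moments over finitely
  supported plans. Moving a near-minimizer slightly towards a Dirac mass at \<open>x\<close> cannot lower the
  value; to first order this is the dual constraint at \<open>x\<close> for the potential below.\<close>

lemma penalized_potential:
  fixes \<phi> :: "nat \<Rightarrow> 'a::euclidean_space \<Rightarrow> real" and \<rho> :: "'a measure"
  assumes N: "N \<ge> 1" and \<rho>: "\<rho> \<in> borel_subprobs"
    and \<phi>: "\<And>k. \<phi> k \<in> C0" "\<And>k x. 0 \<le> \<phi> k x" "\<And>k x. \<phi> k x \<le> 1" and \<eta>: "\<eta> > 0"
  obtains \<psi> \<mu> t where "\<psi> \<in> admissible N" "\<mu> \<in> borel_probs" "0 \<le> t" "transport_cost N \<mu> \<le> ennreal t"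
    "t + 2 * real n * (\<Sum>k<n. ((\<integral>x. \<phi> k x \<partial>\<mu>) - (\<integral>x. \<phi> k x \<partial>\<rho>))\<^sup>2) \<le> dual_value \<rho> \<psi> + \<eta>"
proof -
  define R where "R k = (\<integral>x. \<phi> k x \<partial>\<rho>)" for k
  define E where "E q k = measure_pmf.expectation q (mean_test N (\<phi> k))" for q k
  \<comment> \<open>The real number t dominates the cost of q, which keeps the penalized functional
    real-valued.\<close>
  define adm where "adm q t \<longleftrightarrow> finite (set_pmf q) \<and> 0 \<le> t \<and>
      (\<integral>\<^sup>+x. coulomb_cost N x \<partial>measure_pmf q) \<le> ennreal t" for q :: "(nat \<Rightarrow> 'a) pmf" and t
  define F where "F q t = t + real n * (\<Sum>k<n. (E q k - R k)\<^sup>2)" for q t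
  define V where "V = {F q t | q t. adm q t}"
  have mt: "0 \<le> mean_test N (\<phi> k) x" "mean_test N (\<phi> k) x \<le> 1" for k x
  proof -
    show "0 \<le> mean_test N (\<phi> k) x" unfolding mean_test_def by (intro mult_nonneg_nonneg sum_nonneg \<phi>) auto
    have "(\<Sum>i\<in>{1..N}. \<phi> k (x i)) \<le> (\<Sum>i\<in>{1..N}. 1)" by (intro sum_mono \<phi>)
    then show "mean_test N (\<phi> k) x \<le> 1" using N by (simp add: mean_test_def)
  qed
  have E01: "0 \<le> E q k" "E q k \<le> 1" if "finite (set_pmf q)" for q k
  proof -
    have "integrable (measure_pmf q) (mean_test N (\<phi> k))" using that by (rule integrable_measure_pmf_finite)
    then have "E q k \<le> measure_pmf.expectation q (\<lambda>_. 1)" unfolding E_def by (intro integral_mono) (auto simp: mt)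
    then show "E q k \<le> 1" by simp
    show "0 \<le> E q k" unfolding E_def by (intro Bochner_Integration.integral_nonneg) (auto simp: mt)
  qed
  have V0: "0 \<le> v" if "v \<in> V" for v using that by (auto simp: V_def F_def adm_def intro!: add_nonneg_nonneg mult_nonneg_nonneg sum_nonneg)
  obtain x0 :: "nat \<Rightarrow> 'a" where x0: "coulomb_cost N x0 < \<infinity>" by (rule coulomb_cost_finite_point)
  have "adm (return_pmf x0) (enn2real (coulomb_cost N x0))"
    using x0 by (simp add: adm_def less_top)
  then have Vne: "V \<noteq> {}" by (auto simp: V_def)
  have bdd: "bdd_below V" using V0 by (rule bdd_belowI)
  \<comment> \<open>The weight of the Dirac mass in the perturbation, so small that \<eta> / 2
    absorbs the second-order error. The summand 1 avoids division by 0 when n = 0.\<close>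
  define \<theta> where "\<theta> = min 1 (\<eta> / (2 * ((real n)\<^sup>2 + 1)))"
  have \<theta>: "0 < \<theta>" "\<theta> \<le> 1" using \<eta> by (auto simp: \<theta>_def add_nonneg_pos)
  have "\<theta> * ((real n)\<^sup>2 + 1) \<le> \<eta> / (2 * ((real n)\<^sup>2 + 1)) * ((real n)\<^sup>2 + 1)"
    unfolding \<theta>_def by (intro mult_right_mono) auto
  also have "\<dots> = \<eta> / 2"
  proof -
    have "(real n)\<^sup>2 + 1 \<noteq> 0" using zero_le_power2[of "real n"] by linarith
    then show ?thesis by (simp add: field_simps)
  qed
  finally have \<theta>n: "(real n)\<^sup>2 * \<theta> \<le> \<eta> / 2" using \<theta> by (simp add: algebra_simps)
  \<comment> \<open>This tolerance becomes \<eta> / 2 after division by \<theta>; with the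
    second-order error it makes up the \<eta> subtracted in \<open>b\<close>.\<close>
  obtain v where "v \<in> V" "v < Inf V + \<theta> * \<eta> / 2"
    using cInf_lessD[OF Vne, of "Inf V + \<theta> * \<eta> / 2"] \<theta> \<eta> by auto
  then obtain q t where q: "adm q t" "F q t < Inf V + \<theta> * \<eta> / 2" by (auto simp: V_def)
  have fin: "finite (set_pmf q)" and t: "0 \<le> t" and qt: "(\<integral>\<^sup>+x. coulomb_cost N x \<partial>measure_pmf q) \<le> ennreal t"
    using q(1) by (auto simp: adm_def)
  define e where "e k = E q k - R k" for k
  \<comment> \<open>The coefficients of \<open>\<psi>0\<close> are minus the derivatives of the
    penalty in the moments, and \<open>b\<close> is the constant that turns the first-order
    condition at x into the dual constraint at x.\<close>
  define b where "b = t + 2 * real n * (\<Sum>k<n. e k * E q k) - \<eta>"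
  define \<psi>0 where "\<psi>0 = (\<lambda>x. \<Sum>k<n. (- 2 * real n * e k) * \<phi> k x)"
  define \<psi> where "\<psi> = (\<lambda>x. \<psi>0 x + b)"
  have \<psi>0: "\<psi>0 \<in> C0" unfolding \<psi>0_def by (rule C0_sum[OF \<phi>(1)])
  then have psi: "\<psi> \<in> C0_plus_const" unfolding \<psi>_def C0_plus_const_def by blast
  have lim: "value_at_infinity \<psi> = b"
  proof (rule value_at_infinity_eq)
    have "(\<psi> \<longlongrightarrow> 0 + b) at_infinity" unfolding \<psi>_def using \<psi>0 by (intro tendsto_intros) (auto simp: C0_def)
    then show "(\<psi> \<longlongrightarrow> b) at_infinity" by simp
  qed
  have "\<psi> \<in> admissible N"
  proof (rule admissibleI[OF psi])
    fix x :: "nat \<Rightarrow> 'a" assume x: "coulomb_cost N x < \<infinity>"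
    define c where "c = enn2real (coulomb_cost N x)"
    have c: "0 \<le> c" "coulomb_cost N x = ennreal c" using x by (auto simp: c_def less_top)
    \<comment> \<open>Mixing q with the Dirac mass at x turns both the cost bound and the moments
      into convex combinations.\<close>
    define q' where "q' = bernoulli_pmf \<theta> \<bind> (\<lambda>s. if s then return_pmf x else q)"
    have fin': "finite (set_pmf q')" using fin by (auto simp: q'_def)
    have "(\<integral>\<^sup>+x. coulomb_cost N x \<partial>measure_pmf q')
        = coulomb_cost N x * ennreal \<theta> + (\<integral>\<^sup>+x. coulomb_cost N x \<partial>measure_pmf q) * ennreal (1 - \<theta>)"
      using \<theta> unfolding q'_def by simp
    also have "\<dots> \<le> ennreal c * ennreal \<theta> + ennreal t * ennreal (1 - \<theta>)"
      unfolding c(2) by (intro add_left_mono mult_right_mono qt) auto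
    also have "\<dots> = ennreal (c * \<theta> + t * (1 - \<theta>))"
      using c(1) t \<theta> by (simp add: ennreal_mult ennreal_plus)
    finally have "adm q' (c * \<theta> + t * (1 - \<theta>))" using fin' c(1) t \<theta> by (simp add: adm_def)
    then have "Inf V \<le> F q' (c * \<theta> + t * (1 - \<theta>))" by (intro cInf_lower[OF _ bdd]) (auto simp: V_def)
    then have *: "F q t \<le> F q' (c * \<theta> + t * (1 - \<theta>)) + \<theta> * \<eta> / 2" using q(2) by linarith
    define d where "d k = mean_test N (\<phi> k) x - E q k" for k
    have E': "E q' k - R k = e k + \<theta> * d k" for k
    proof -
      have "E q' k = (\<Sum>s\<in>UNIV. pmf (bernoulli_pmf \<theta>) s *\<^sub>R
          measure_pmf.expectation (if s then return_pmf x else q) (mean_test N (\<phi> k)))"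
        unfolding E_def q'_def using fin by (intro pmf_expectation_bind) auto
      also have "\<dots> = \<theta> * mean_test N (\<phi> k) x + (1 - \<theta>) * E q k"
        using \<theta> by (simp add: UNIV_bool E_def)
      finally show ?thesis by (simp add: e_def d_def algebra_simps)
    qed
    \<comment> \<open>Both moments lie in [0, 1], which bounds the quadratic term in \<theta>
      independently of x.\<close>
    have d1: "(d k)\<^sup>2 \<le> 1" for k
      using mt[of k x] E01[OF fin, of k] by (simp add: d_def abs_square_le_1 abs_le_iff)
    have "(\<Sum>k<n. (e k + \<theta> * d k)\<^sup>2) = (\<Sum>k<n. (e k)\<^sup>2 + (2 * \<theta> * (e k * d k) + \<theta>\<^sup>2 * (d k)\<^sup>2))"
      by (intro sum.cong refl) (simp add: power2_eq_square algebra_simps)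
    also have "\<dots> = (\<Sum>k<n. (e k)\<^sup>2) + 2 * \<theta> * (\<Sum>k<n. e k * d k) + \<theta>\<^sup>2 * (\<Sum>k<n. (d k)\<^sup>2)"
      by (simp add: sum.distrib sum_distrib_left)
    also have "\<dots> \<le> (\<Sum>k<n. (e k)\<^sup>2) + 2 * \<theta> * (\<Sum>k<n. e k * d k) + \<theta>\<^sup>2 * real n"
      using sum_mono[of "{..<n}" "\<lambda>k. (d k)\<^sup>2" "\<lambda>_. 1"] d1 by (auto intro!: mult_left_mono)
    finally have "real n * (\<Sum>k<n. (e k + \<theta> * d k)\<^sup>2)
        \<le> real n * ((\<Sum>k<n. (e k)\<^sup>2) + 2 * \<theta> * (\<Sum>k<n. e k * d k) + \<theta>\<^sup>2 * real n)"
      by (intro mult_left_mono) auto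
    then have "\<theta> * t \<le> \<theta> * c + real n * (2 * \<theta> * (\<Sum>k<n. e k * d k) + \<theta>\<^sup>2 * real n) + \<theta> * \<eta> / 2"
      using * by (simp add: F_def E' e_def[symmetric] algebra_simps)
    also have "\<dots> = \<theta> * (c + 2 * real n * (\<Sum>k<n. e k * d k) + (real n)\<^sup>2 * \<theta> + \<eta> / 2)"
      by (simp add: power2_eq_square algebra_simps)
    finally have "t \<le> c + 2 * real n * (\<Sum>k<n. e k * d k) + (real n)\<^sup>2 * \<theta> + \<eta> / 2"
      using \<theta>(1) by (simp only: mult_le_cancel_left_pos)
    then have "t - 2 * real n * (\<Sum>k<n. e k * d k) - \<eta> \<le> c" using \<theta>n by linarith
    also have "t - 2 * real n * (\<Sum>k<n. e k * d k) - \<eta>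
        = b - 2 * real n * (\<Sum>k<n. e k * mean_test N (\<phi> k) x)"
      by (simp add: b_def d_def right_diff_distrib sum_subtractf)
    also have "\<dots> = mean_test N \<psi> x"
    proof -
      have "mean_test N \<psi> x = mean_test N \<psi>0 x + b"
        using N by (simp add: mean_test_def \<psi>_def sum.distrib field_simps)
      also have "(\<Sum>i\<in>{1..N}. \<psi>0 (x i)) = (\<Sum>k<n. (- 2 * real n * e k) * (\<Sum>i\<in>{1..N}. \<phi> k (x i)))"
        unfolding \<psi>0_def by (subst sum.swap) (simp only: sum_distrib_left)
      then have "mean_test N \<psi>0 x = - 2 * real n * (\<Sum>k<n. e k * mean_test N (\<phi> k) x)"
        by (simp add: mean_test_def sum_distrib_left sum_divide_distrib mult_ac sum_negf)
      finally show ?thesis by simp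
    qed
    finally show "mean_test N \<psi> x \<le> enn2real (coulomb_cost N x)" by (simp add: c_def)
  qed
  moreover define \<mu> where "\<mu> = borel_of_pmf (averaged_marginal N q)"
  have "\<mu> \<in> borel_probs" unfolding \<mu>_def by (rule borel_of_pmf_borel_probs)
  moreover have "transport_cost N \<mu> \<le> ennreal t"
    unfolding \<mu>_def using transport_cost_averaged_marginal_le[OF N] qt by (rule order_trans)
  moreover have "(\<integral>x. \<phi> k x \<partial>\<mu>) = E q k" for k
  proof -
    have "\<phi> k \<in> borel_measurable borel" using \<phi>(1) by (intro borel_measurable_continuous_onI) (auto simp: C0_def)
    then show ?thesis
      unfolding \<mu>_def E_def by (subst integral_averaged_marginal[OF N fin]) (auto simp: mean_test_def[abs_def])
  qed
  \<comment> \<open>Integration pairs \<open>e\<close> with \<open>R\<close> while \<open>b\<close>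
    pairs it with \<open>E\<close>; their difference is \<open>e\<close> again, so the penalty
    appears with factor 2.\<close>
  moreover have "dual_value \<rho> \<psi> = t + 2 * real n * (\<Sum>k<n. (e k)\<^sup>2) - \<eta>"
  proof -
    have "dual_value \<rho> \<psi> = (\<integral>x. \<psi>0 x \<partial>\<rho>) + b"
      by (subst dual_value_alt[OF \<rho> psi]) (simp add: lim, simp add: \<psi>_def)
    also have "(\<integral>x. \<psi>0 x \<partial>\<rho>) = (\<Sum>k<n. (- 2 * real n * e k) * R k)"
      unfolding \<psi>0_def R_def using C0_integrable[OF \<rho> \<phi>(1)] by (subst Bochner_Integration.integral_sum) auto
    also have "\<dots> + b = t + 2 * real n * (\<Sum>k<n. e k * E q k - e k * R k) - \<eta>"
      by (simp add: b_def sum_distrib_left sum_subtractf sum_negf right_diff_distrib mult_ac)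
    also have "(\<Sum>k<n. e k * E q k - e k * R k) = (\<Sum>k<n. (e k)\<^sup>2)"
      by (intro sum.cong refl) (simp add: e_def power2_eq_square algebra_simps)
    finally show ?thesis .
  qed
  ultimately show ?thesis
    using t by (intro that[of \<psi> \<mu> t]) (auto simp: e_def R_def)
qed

text \<open>The penalized potentials have dual value at most D. The penalty with weight n + 1 thus
  stays bounded and forces every moment to converge, while the costs stay below D + 1 / (n + 1), so
  the marginals form a recovery sequence.\<close>

lemma relaxed_cost_le:
  fixes \<rho> :: "'a::euclidean_space measure"
  assumes N: "N \<ge> 1" and \<rho>: "\<rho> \<in> borel_subprobs"
    and D: "\<And>\<psi>. \<psi> \<in> admissible N \<Longrightarrow> dual_value \<rho> \<psi> \<le> D"
  shows "relaxed_cost N \<rho> \<le> ennreal D"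
proof -
  obtain \<phi> :: "nat \<Rightarrow> 'a \<Rightarrow> real" where \<phi>: "\<And>k. \<phi> k \<in> C0" "\<And>k x. 0 \<le> \<phi> k x" "\<And>k x. \<phi> k x \<le> 1"
    and test: "\<forall>\<mu> \<rho>. (\<forall>n. \<mu> n \<in> borel_probs) \<longrightarrow> \<rho> \<in> borel_subprobs \<longrightarrow>
        (\<forall>k. (\<lambda>n. \<integral>x. \<phi> k x \<partial>\<mu> n) \<longlonglongrightarrow> (\<integral>x. \<phi> k x \<partial>\<rho>)) \<longrightarrow> weak_star_conv \<mu> \<rho>"
    by (rule weak_star_test_functions) blast
  define R where "R k = (\<integral>x. \<phi> k x \<partial>\<rho>)" for k
  define G where "G n \<mu> t \<longleftrightarrow> \<mu> \<in> borel_probs \<and> 0 \<le> t \<and> transport_cost N \<mu> \<le> ennreal t \<and>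
      t + 2 * real (Suc n) * (\<Sum>k<Suc n. ((\<integral>x. \<phi> k x \<partial>\<mu>) - R k)\<^sup>2) \<le> D + 1 / real (Suc n)" for n \<mu> t
  have "\<exists>p. G n (fst p) (snd p)" for n
  proof -
    obtain \<psi> \<mu> t where *: "\<psi> \<in> admissible N" "\<mu> \<in> borel_probs" "0 \<le> t" "transport_cost N \<mu> \<le> ennreal t"
      "t + 2 * real (Suc n) * (\<Sum>k<Suc n. ((\<integral>x. \<phi> k x \<partial>\<mu>) - R k)\<^sup>2) \<le> dual_value \<rho> \<psi> + 1 / real (Suc n)"
      unfolding R_def by (rule penalized_potential[OF N \<rho> \<phi>, of "1 / real (Suc n)" "Suc n"]) auto
    have "G n \<mu> t" unfolding G_def using *(2-5) D[OF *(1)] by linarith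
    then show ?thesis by (intro exI[of _ "(\<mu>, t)"]) simp
  qed
  then obtain p where p: "\<And>n. G n (fst (p n)) (snd (p n))" by metis
  define \<mu> t where "\<mu> n = fst (p n)" and "t n = snd (p n)" for n
  have \<mu>: "\<And>n. \<mu> n \<in> borel_probs" and t: "\<And>n. 0 \<le> t n" "\<And>n. transport_cost N (\<mu> n) \<le> ennreal (t n)"
    and le: "\<And>n. t n + 2 * real (Suc n) * (\<Sum>k<Suc n. ((\<integral>x. \<phi> k x \<partial>\<mu> n) - R k)\<^sup>2) \<le> D + 1 / real (Suc n)"
    using p by (auto simp only: G_def \<mu>_def t_def)
  have "(\<lambda>n. \<integral>x. \<phi> k x \<partial>\<mu> n) \<longlonglongrightarrow> R k" for k
  proof -
    have lim0: "(\<lambda>n. (D + 1) / (2 * real (Suc n))) \<longlonglongrightarrow> 0"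
      by real_asymp
    have "(\<lambda>n. ((\<integral>x. \<phi> k x \<partial>\<mu> n) - R k)\<^sup>2) \<longlonglongrightarrow> 0"
    proof (rule tendsto_sandwich[OF _ _ tendsto_const lim0])
      \<comment> \<open>From n = k on, the defect with index k is among the penalized ones.\<close>
      show "eventually (\<lambda>n. ((\<integral>x. \<phi> k x \<partial>\<mu> n) - R k)\<^sup>2 \<le> (D + 1) / (2 * real (Suc n))) sequentially"
        using eventually_ge_at_top[of k]
      proof eventually_elim
        case (elim n)
        let ?a = "((\<integral>x. \<phi> k x \<partial>\<mu> n) - R k)\<^sup>2" and ?S = "\<Sum>k<Suc n. ((\<integral>x. \<phi> k x \<partial>\<mu> n) - R k)\<^sup>2"
        have "?a \<le> ?S"
          using elim by (intro member_le_sum[where f = "\<lambda>k. ((\<integral>x. \<phi> k x \<partial>\<mu> n) - R k)\<^sup>2"]) auto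
        then have "2 * real (Suc n) * ?a \<le> 2 * real (Suc n) * ?S" by (intro mult_left_mono) auto
        also have "\<dots> \<le> D + 1 / real (Suc n)" using le[of n] t(1)[of n] by linarith
        also have "\<dots> \<le> D + 1" by simp
        finally show ?case by (subst pos_le_divide_eq) (simp_all add: mult_ac)
      qed
    qed auto
    then have "(\<lambda>n. \<bar>(\<integral>x. \<phi> k x \<partial>\<mu> n) - R k\<bar>) \<longlonglongrightarrow> 0"
      using tendsto_real_sqrt[of _ 0] by fastforce
    then show ?thesis by (simp add: tendsto_rabs_zero_iff LIM_zero_iff)
  qed
  then have "weak_star_conv \<mu> \<rho>" using test \<mu> \<rho> unfolding R_def by blast
  then have "relaxed_cost N \<rho> \<le> liminf (\<lambda>n. transport_cost N (\<mu> n))"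
    unfolding relaxed_cost_def using \<mu> by (intro Inf_lower) auto
  also have "\<dots> \<le> liminf (\<lambda>n. ennreal (D + 1 / real (Suc n)))"
  proof (intro Liminf_mono always_eventually allI)
    fix n
    have "0 \<le> 2 * real (Suc n) * (\<Sum>k<Suc n. ((\<integral>x. \<phi> k x \<partial>\<mu> n) - R k)\<^sup>2)"
      by (intro mult_nonneg_nonneg sum_nonneg) auto
    then have "t n \<le> D + 1 / real (Suc n)" using le[of n] by linarith
    then show "transport_cost N (\<mu> n) \<le> ennreal (D + 1 / real (Suc n))"
      using t(2)[of n] by (meson ennreal_leI order_trans)
  qed
  also have "\<dots> = ennreal D"
  proof (rule lim_imp_Liminf)
    have "(\<lambda>n. D + 1 / real (Suc n)) \<longlonglongrightarrow> D" by real_asymp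
    then show "(\<lambda>n. ennreal (D + 1 / real (Suc n))) \<longlonglongrightarrow> ennreal D" by (rule tendsto_ennrealI)
  qed simp
  finally show ?thesis .
qed

section \<open>Attainment\<close>

text \<open>A diagonal sequence converges on a countable dense set, and the common Lipschitz
  constant carries the Cauchy property to all finite points. It says nothing about
  \<open>None\<close>, which is therefore added to the countable set.\<close>

lemma equilipschitz_subsequence:
  fixes u :: "nat \<Rightarrow> 'a::euclidean_space option \<Rightarrow> real"
  assumes bound: "\<And>n y. \<bar>u n y\<bar> \<le> B" and lip: "\<And>n. L-lipschitz_on UNIV (\<lambda>x. u n (Some x))"
  obtains k v where "strict_mono (k :: nat \<Rightarrow> nat)" "\<And>y. (\<lambda>n. u (k n) y) \<longlonglongrightarrow> v y"
proof -
  obtain D :: "'a set" where cD: "countable D" and D: "\<And>X. open X \<Longrightarrow> X \<noteq> {} \<Longrightarrow> \<exists>d\<in>D. d \<in> X"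
    using countable_dense_setE by metis
  have "countable (insert None (Some ` D))" using cD by simp
  then obtain k where k: "strict_mono (k :: nat \<Rightarrow> nat)"
    and kS: "\<And>y. y \<in> insert None (Some ` D) \<Longrightarrow> \<exists>l. (\<lambda>n. u (k n) y) \<longlonglongrightarrow> l"
    by (rule function_convergent_subsequence[of _ u B]) (use bound in auto)
  have L: "L \<ge> 0" using lip by (rule lipschitz_on_nonneg)
  have "Cauchy (\<lambda>n. u (k n) (Some x))" for x
  proof (rule metric_CauchyI)
    fix e :: real assume e: "e > 0"
    \<comment> \<open>The denominator contains L + 1 because L may be 0.\<close>
    define h where "h = e / (3 * (L + 1))"
    have h: "h > 0" using e L by (auto simp: h_def)
    then obtain d where d: "d \<in> D" "dist x d < h" using D[of "ball x h"] by auto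
    have "L * dist x d \<le> (L + 1) * h" using d L by (intro mult_mono) auto
    also have "(L + 1) * h = e / 3" using L by (simp add: h_def field_simps)
    finally have "L * dist x d \<le> e / 3" .
    then have near: "\<bar>u n (Some x) - u n (Some d)\<bar> \<le> e / 3" for n
      using lipschitz_onD[OF lip[of n], of x d] unfolding dist_real_def by auto
    have "Cauchy (\<lambda>n. u (k n) (Some d))"
      using kS[of "Some d"] d(1) by (auto intro: LIMSEQ_imp_Cauchy)
    then obtain M where M: "\<And>m n. m \<ge> M \<Longrightarrow> n \<ge> M \<Longrightarrow> dist (u (k m) (Some d)) (u (k n) (Some d)) < e / 3"
      using metric_CauchyD[of _ "e / 3"] e by fastforce
    have "dist (u (k m) (Some x)) (u (k n) (Some x)) < e" if "m \<ge> M" "n \<ge> M" for m n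
      using M[OF that] near[of "k m"] near[of "k n"] unfolding dist_real_def by linarith
    then show "\<exists>M. \<forall>m\<ge>M. \<forall>n\<ge>M. dist (u (k m) (Some x)) (u (k n) (Some x)) < e" by blast
  qed
  then have "\<exists>l. (\<lambda>n. u (k n) y) \<longlonglongrightarrow> l" for y
    using kS[of None] Cauchy_convergent by (cases y) (auto simp: convergent_def)
  then obtain v where "\<And>y. (\<lambda>n. u (k n) y) \<longlonglongrightarrow> v y" by metis
  then show ?thesis using k that by blast
qed

text \<open>The upper bound is feasibility with the other arguments at infinity. The lower bound
  comes from the fixed point equation: the cost is nonnegative and the other N - 1 values are at
  most M.\<close>

lemma fixpoint_bounds:
  assumes N: "N \<ge> 1" and r: "r > 0" and u: "feasible N r u" "ctrans N r u = u"
    and M: "(real N - 1) * - u None \<le> M" "0 \<le> M"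
  shows "\<bar>u y\<bar> \<le> real N * M"
proof -
  have up: "u y \<le> M" for y using feasible_at_most[OF N u(1), of y] M(1) by (simp add: left_diff_distrib)
  have "- (real N * M) \<le> ctrans N r u y"
  proof (rule ctrans_greatest[OF N])
    fix k and x :: "nat \<Rightarrow> 'a option" assume k: "k \<in> {1..N}"
    have "(\<Sum>i\<in>{1..N} - {k}. u (x i)) \<le> (\<Sum>i\<in>{1..N} - {k}. M)" using up by (intro sum_mono)
    also have "\<dots> \<le> (\<Sum>i\<in>{1..N}. M)" using M by (intro sum_mono2) auto
    finally have "(\<Sum>i\<in>{1..N} - {k}. u (x i)) \<le> real N * M" by simp
    moreover have "0 \<le> real N * trunc_cost N r (x(k := y))"
      by (intro mult_nonneg_nonneg trunc_cost_nonneg r) simp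
    ultimately show "- (real N * M) \<le> real N * trunc_cost N r (x(k := y)) - (\<Sum>i\<in>{1..N} - {k}. u (x i))"
      by linarith
  qed
  moreover have "M \<le> real N * M" using N M(2) by (simp add: mult_le_cancel_right1)
  ultimately show ?thesis using up[of y] u(2) by (simp add: abs_le_iff)
qed

lemma mass_le_1: "\<rho> \<in> borel_subprobs \<Longrightarrow> mass \<rho> \<le> 1"
  by (auto simp: mass_def borel_subprobs_def measure_def intro!: enn2real_leI)

lemma dual_value_mono:
  fixes \<psi> u :: "'a::euclidean_space \<Rightarrow> real"
  assumes \<rho>: "\<rho> \<in> borel_subprobs" and "\<psi> \<in> C0_plus_const" "u \<in> C0_plus_const"
    and "\<And>x. \<psi> x \<le> u x" "value_at_infinity \<psi> \<le> value_at_infinity u"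
  shows "dual_value \<rho> \<psi> \<le> dual_value \<rho> u"
  unfolding dual_value_def
  using assms mass_le_1[OF \<rho>]
  by (intro add_mono integral_mono mult_left_mono C0_plus_const_integrable) auto

lemma dual_value_zero: "dual_value (\<rho> :: 'a::euclidean_space measure) (\<lambda>_. 0) = 0"
  using value_at_infinity_eq[of "\<lambda>_::'a. 0" 0] by (simp add: dual_value_def)

text \<open>The open set where v < w is null, because w - v is nonnegative with integral 0, and an
  open null set cannot meet the support.\<close>

lemma eq_on_msupport:
  fixes v w :: "'a::euclidean_space \<Rightarrow> real"
  assumes \<rho>: "\<rho> \<in> borel_subprobs" and v: "v \<in> C0_plus_const" and w: "w \<in> C0_plus_const"
    and le: "\<And>x. v x \<le> w x" and int: "(\<integral>x. w x \<partial>\<rho>) \<le> (\<integral>x. v x \<partial>\<rho>)" and x: "x \<in> msupport \<rho>"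
  shows "v x = w x"
proof (rule ccontr)
  assume "v x \<noteq> w x"
  define U where "U = {x. v x < w x}"
  have "open U" unfolding U_def
    using v w by (intro open_Collect_less) (auto simp: C0_plus_const_iff)
  moreover have "x \<in> U" using \<open>v x \<noteq> w x\<close> le[of x] by (simp add: U_def)
  ultimately have pos: "emeasure \<rho> U > 0" using x by (auto simp: msupport_def)
  have intg: "integrable \<rho> (\<lambda>x. w x - v x)"
    using C0_plus_const_integrable[OF \<rho>] v w by auto
  have "(\<integral>x. w x - v x \<partial>\<rho>) = (\<integral>x. w x \<partial>\<rho>) - (\<integral>x. v x \<partial>\<rho>)"
    using C0_plus_const_integrable[OF \<rho>] v w by auto
  moreover have "0 \<le> (\<integral>x. w x - v x \<partial>\<rho>)" using le by (intro Bochner_Integration.integral_nonneg) auto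
  ultimately have "(\<integral>x. w x - v x \<partial>\<rho>) = 0" using int by linarith
  then have "AE x in \<rho>. w x - v x = 0"
    using integral_nonneg_eq_0_iff_AE[OF intg] le by auto
  then have "AE x in \<rho>. x \<notin> U" by (rule AE_mp) (auto simp: U_def)
  moreover have "U \<in> sets \<rho>" using \<open>open U\<close> \<rho> by (auto simp: borel_subprobs_def)
  ultimately have "emeasure \<rho> U = 0"
    using borel_subprobs_space[OF \<rho>] by (subst (asm) AE_iff_measurable[of U]) auto
  then show False using pos by simp
qed

text \<open>The Lipschitz constant is that of the transform for a radius determined by N, \<delta>
  and the relaxed cost of (1 + \<delta>) \<rho>; the measure enters only through this cost.\<close>

lemma dual_attainment:
  fixes \<rho> :: "'a::euclidean_space measure"
  defines "L \<equiv> \<lambda>N \<delta> K. real N ^ 3 * ((real N - 1) * enn2real K / \<delta> + 1)\<^sup>2"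
  assumes N: "N \<ge> 1" and \<rho>: "\<rho> \<in> borel_subprobs" and \<delta>: "\<delta> > 0"
    and \<rho>': "scale_measure (ennreal (1 + \<delta>)) \<rho> \<in> borel_subprobs"
    and fin: "relaxed_cost N (scale_measure (ennreal (1 + \<delta>)) \<rho>) < \<infinity>"
  shows "\<exists>u\<in>admissible N.
      (L N \<delta> (relaxed_cost N (scale_measure (ennreal (1 + \<delta>)) \<rho>)))-lipschitz_on UNIV u \<and>
      enn2ereal (relaxed_cost N \<rho>) = ereal (dual_value \<rho> u) \<and> ereal (dual_value \<rho> u) = dual_sup N \<rho>"
    and "\<And>v. v \<in> admissible N \<Longrightarrow> ereal (dual_value \<rho> v) = dual_sup N \<rho> \<Longrightarrow>
      \<exists>w\<in>admissible N. (\<exists>K. K-lipschitz_on UNIV w) \<and> ereal (dual_value \<rho> w) = dual_sup N \<rho> \<and>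
         (\<forall>x\<in>msupport \<rho>. v x = w x)"
proof -
  define K where "K = enn2real (relaxed_cost N (scale_measure (ennreal (1 + \<delta>)) \<rho>))"
  \<comment> \<open>Potentials of nonnegative dual value have value at infinity at least - K /
    \<delta>, hence are bounded above by M. The radius uses M + 1 because M may be 0.\<close>
  define M where "M = (real N - 1) * K / \<delta>"
  define r where "r = 1 / (M + 1)"
  have K: "K \<ge> 0" by (simp add: K_def)
  have M: "M \<ge> 0" using K N \<delta> by (simp add: M_def)
  then have r: "r > 0" "M \<le> 1 / r" by (auto simp: r_def)
  have Lr: "real N ^ 3 / r\<^sup>2 = L N \<delta> (relaxed_cost N (scale_measure (ennreal (1 + \<delta>)) \<rho>))"
    by (simp add: L_def r_def M_def K_def power_divide)
  have C0pc: "\<psi> \<in> C0_plus_const" if "\<psi> \<in> admissible N" for \<psi> :: "'a \<Rightarrow> real"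
    using that by (auto simp: admissible_def)
  have scale: "(1 + \<delta>) * dual_value \<rho> \<psi> - \<delta> * value_at_infinity \<psi> \<le> K" if "\<psi> \<in> admissible N" for \<psi>
    unfolding K_def by (rule dual_value_scale_bound[OF N \<rho> \<delta> \<rho>' fin that])
  have dual_bdd: "dual_value \<rho> \<psi> \<le> K / (1 + \<delta>)" if \<psi>: "\<psi> \<in> admissible N" for \<psi>
  proof -
    have "\<delta> * value_at_infinity \<psi> \<le> 0"
      using admissible_at_infinity_bounds(2)[OF N \<psi>] \<delta> by (simp add: mult_le_0_iff)
    then have "(1 + \<delta>) * dual_value \<rho> \<psi> \<le> K" using scale[OF \<psi>] by linarith
    then show ?thesis using \<delta> by (simp add: pos_le_divide_eq mult.commute)
  qed
  have inf_bound: "- value_at_infinity \<psi> \<le> K / \<delta>" if "\<psi> \<in> admissible N" "0 \<le> dual_value \<rho> \<psi>" for \<psi>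
  proof -
    have "0 \<le> (1 + \<delta>) * dual_value \<rho> \<psi>" using that(2) \<delta> by simp
    then have "\<delta> * - value_at_infinity \<psi> \<le> K" using scale[OF that(1)] by simp
    then show ?thesis using \<delta> by (simp add: pos_le_divide_eq mult.commute)
  qed
  have M_bound: "(real N - 1) * - a \<le> M" if "- a \<le> K / \<delta>" for a
  proof -
    have "(real N - 1) * - a \<le> (real N - 1) * (K / \<delta>)" using that N by (intro mult_left_mono) auto
    then show ?thesis by (simp add: M_def)
  qed
  have reg: "\<exists>u. feasible N r u \<and> ctrans N r u = u \<and> (\<forall>x. \<psi> x \<le> u (Some x)) \<and> value_at_infinity \<psi> \<le> u None
      \<and> - u None \<le> K / \<delta>"
    if \<psi>: "\<psi> \<in> admissible N" "0 \<le> dual_value \<rho> \<psi>" for \<psi>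
  proof -
    have "\<psi> x \<le> 1 / r" for x
      using admissible_at_infinity_bounds(1)[OF N \<psi>(1), of x] M_bound[OF inf_bound[OF \<psi>]] r(2)
      by (simp add: left_diff_distrib)
    then obtain u where "feasible N r u" "ctrans N r u = u" "\<And>x. \<psi> x \<le> u (Some x)" "value_at_infinity \<psi> \<le> u None"
      using admissible_regularize[OF N r(1) \<psi>(1)] by metis
    moreover from this have "- u None \<le> K / \<delta>" using inf_bound[OF \<psi>] by linarith
    ultimately show ?thesis by blast
  qed
  note fp = fixpoint_admissible[OF N r(1)]
  \<comment> \<open>The dual value with the value at \<open>None\<close> in place of a limit: it
    makes sense also for pointwise limits that may be discontinuous at infinity.\<close>
  define J where "J u = (\<integral>x. u (Some x) \<partial>\<rho>) + (1 - mass \<rho>) * u None" for u :: "'a option \<Rightarrow> real"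
  have J: "dual_value \<rho> (\<lambda>x. u (Some x)) = J u" if "feasible N r u" "ctrans N r u = u" for u
    using fp(3)[OF that] by (simp add: dual_value_def J_def)
  have J_mono: "dual_value \<rho> \<psi> \<le> J u"
    if "\<psi> \<in> admissible N" "feasible N r u" "ctrans N r u = u" "\<forall>x. \<psi> x \<le> u (Some x)"
      "value_at_infinity \<psi> \<le> u None" for \<psi> u
    unfolding J[OF that(2,3), symmetric]
    using that fp[OF that(2,3)] by (intro dual_value_mono[OF \<rho>] C0pc) auto
  define s where "s = (SUP \<psi>\<in>admissible N. dual_value \<rho> \<psi>)"
  have bdd: "bdd_above (dual_value \<rho> ` admissible N)" using dual_bdd by (rule bdd_aboveI2)
  have le_s: "dual_value \<rho> \<psi> \<le> s" if "\<psi> \<in> admissible N" for \<psi>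
    unfolding s_def using that bdd by (rule cSUP_upper)
  have s0: "0 \<le> s" using le_s[OF zero_admissible] by (simp add: dual_value_zero)
  \<comment> \<open>The bound at infinity is available for nonnegative dual values, so the zero
    potential takes over as long as s - 1 / (n + 1) is nonpositive.\<close>
  have "\<exists>\<psi>. \<psi> \<in> admissible N \<and> 0 \<le> dual_value \<rho> \<psi> \<and> s - 1 / real (Suc n) \<le> dual_value \<rho> \<psi>" for n
  proof (cases "s - 1 / real (Suc n) \<le> 0")
    case True
    then show ?thesis using zero_admissible by (intro exI[of _ "\<lambda>_. 0"]) (simp add: dual_value_zero)
  next
    case False
    have "s - 1 / real (Suc n) < s" by simp
    then obtain \<psi> where "\<psi> \<in> admissible N" "s - 1 / real (Suc n) < dual_value \<rho> \<psi>"
      unfolding s_def using less_cSUP_iff[OF _ bdd] zero_admissible by (metis empty_iff)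
    then show ?thesis using False by (intro exI[of _ \<psi>]) auto
  qed
  then have "\<exists>u. feasible N r u \<and> ctrans N r u = u \<and> - u None \<le> K / \<delta> \<and> s - 1 / real (Suc n) \<le> J u" for n
    by (meson reg J_mono order_trans)
  then obtain u where u: "\<And>n. feasible N r (u n)" "\<And>n. ctrans N r (u n) = u n"
    "\<And>n. - u n None \<le> K / \<delta>" and Ju: "\<And>n. s - 1 / real (Suc n) \<le> J (u n)"
    by metis
  have ub: "\<bar>u n y\<bar> \<le> real N * M" for n y
    by (rule fixpoint_bounds[OF N r(1) u(1,2) M_bound[OF u(3)] M])
  have ul: "(real N ^ 3 / r\<^sup>2)-lipschitz_on UNIV (\<lambda>x. u n (Some x))" for n
    by (rule fp(2)[OF u(1,2)])
  obtain k v where k: "strict_mono (k :: nat \<Rightarrow> nat)" and v: "\<And>y. (\<lambda>n. u (k n) y) \<longlonglongrightarrow> v y"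
    by (rule equilipschitz_subsequence[of u, OF ub ul]) blast
  have fv: "feasible N r v" by (rule feasible_limit[OF u(1) v])
  have vb: "\<bar>v y\<bar> \<le> real N * M" for y
    by (rule LIMSEQ_le_const2[OF tendsto_rabs[OF v]]) (use ub in auto)
  have um: "(\<lambda>x. u n (Some x)) \<in> borel_measurable \<rho>" for n
    using C0_plus_const_integrable[OF \<rho> C0pc[OF fp(1)[OF u(1,2)]]] by auto
  have vm: "(\<lambda>x. v (Some x)) \<in> borel_measurable \<rho>"
    by (rule borel_measurable_LIMSEQ_real[OF v um])
  interpret finite_measure \<rho> by (rule borel_subprobs_finite[OF \<rho>])
  have vi: "integrable \<rho> (\<lambda>x. v (Some x))"
    using vm vb by (intro integrable_const_bound[of _ "real N * M"]) auto
  have "(\<lambda>n. \<integral>x. u (k n) (Some x) \<partial>\<rho>) \<longlonglongrightarrow> (\<integral>x. v (Some x) \<partial>\<rho>)"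
    by (rule integral_dominated_convergence[where w = "\<lambda>_. real N * M"]) (use v vm um ub in auto)
  then have "(\<lambda>n. J (u (k n))) \<longlonglongrightarrow> J v" unfolding J_def by (intro tendsto_intros v)
  moreover have "(\<lambda>n. s - 1 / real (Suc (k n))) \<longlonglongrightarrow> s - 0"
    by (intro tendsto_intros LIMSEQ_subseq_LIMSEQ[OF LIMSEQ_Suc[OF lim_1_over_n] k, unfolded o_def])
  ultimately have sv: "s \<le> J v" using Ju by (intro LIMSEQ_le[of "\<lambda>n. s - 1 / real (Suc (k n))"]) auto
  \<comment> \<open>The limit \<open>v\<close> is feasible but may be discontinuous at infinity. The
    fixed point above it is regular, and passing to it cannot lower \<open>J\<close>.\<close>
  obtain w where w: "feasible N r w" "\<And>y. v y \<le> w y" "ctrans N r w = w"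
    using feasible_fixpoint_above[OF N r(1) fv] by blast
  define u0 where "u0 = (\<lambda>x. w (Some x))"
  have u0: "u0 \<in> admissible N" unfolding u0_def by (rule fp(1)[OF w(1,3)])
  have "J v \<le> J w"
    unfolding J_def using w(2) vi C0_plus_const_integrable[OF \<rho> C0pc[OF u0]] mass_le_1[OF \<rho>]
    by (intro add_mono integral_mono mult_left_mono) (auto simp: u0_def)
  then have u0s: "dual_value \<rho> u0 = s" using sv le_s[OF u0] J[OF w(1,3)] by (simp add: u0_def)
  have sup: "dual_sup N \<rho> = ereal s"
    unfolding dual_sup_def
  proof (rule antisym)
    show "(SUP \<psi>\<in>admissible N. ereal (dual_value \<rho> \<psi>)) \<le> ereal s" using le_s by (intro SUP_least) simp
    show "ereal s \<le> (SUP \<psi>\<in>admissible N. ereal (dual_value \<rho> \<psi>))" using u0 u0s by (intro SUP_upper2[of u0]) auto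
  qed
  have "relaxed_cost N \<rho> = ennreal s"
    using relaxed_cost_le[OF N \<rho> le_s] dual_value_le_relaxed_cost[OF N \<rho> u0] u0s by (intro antisym) auto
  \<comment> \<open>Since s is nonnegative, \<open>ennreal\<close> does not cut it off.\<close>
  then have "enn2ereal (relaxed_cost N \<rho>) = ereal s" using s0 by simp
  then show "\<exists>u\<in>admissible N.
      (L N \<delta> (relaxed_cost N (scale_measure (ennreal (1 + \<delta>)) \<rho>)))-lipschitz_on UNIV u \<and>
      enn2ereal (relaxed_cost N \<rho>) = ereal (dual_value \<rho> u) \<and> ereal (dual_value \<rho> u) = dual_sup N \<rho>"
    using u0 u0s sup fp(2)[OF w(1,3)] Lr by (intro bexI[of _ u0]) (auto simp: u0_def)
  fix v assume v: "v \<in> admissible N" and opt: "ereal (dual_value \<rho> v) = dual_sup N \<rho>"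
  have vs: "dual_value \<rho> v = s" using opt sup by simp
  obtain w where w: "feasible N r w" "ctrans N r w = w" "\<forall>x. v x \<le> w (Some x)" "value_at_infinity v \<le> w None"
    using reg[OF v] vs s0 by auto
  define w0 where "w0 = (\<lambda>x. w (Some x))"
  have w0: "w0 \<in> admissible N" unfolding w0_def by (rule fp(1)[OF w(1,2)])
  have ws: "dual_value \<rho> w0 = s"
    using J_mono[OF v w] le_s[OF w0] J[OF w(1,2)] vs by (simp add: w0_def)
  \<comment> \<open>Both parts of the dual value can only grow from \<open>v\<close> to
    \<open>w0\<close> while their sum stays the same, so the integrals agree.\<close>
  have "(1 - mass \<rho>) * value_at_infinity v \<le> (1 - mass \<rho>) * value_at_infinity w0"
    using w(4) fp(3)[OF w(1,2)] mass_le_1[OF \<rho>] by (intro mult_left_mono) (auto simp: w0_def)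
  then have "(\<integral>x. w0 x \<partial>\<rho>) \<le> (\<integral>x. v x \<partial>\<rho>)"
    using vs ws unfolding dual_value_def by linarith
  moreover have "v x \<le> w0 x" for x using w(3) by (simp add: w0_def)
  ultimately have "\<forall>x\<in>msupport \<rho>. v x = w0 x"
    by (intro ballI eq_on_msupport[OF \<rho> C0pc[OF v] C0pc[OF w0]])
  moreover have "\<exists>K. K-lipschitz_on UNIV w0" unfolding w0_def using fp(2)[OF w(1,2)] by blast
  ultimately show "\<exists>w\<in>admissible N. (\<exists>K. K-lipschitz_on UNIV w) \<and> ereal (dual_value \<rho> w) = dual_sup N \<rho> \<and>
         (\<forall>x\<in>msupport \<rho>. v x = w x)"
    using ws sup by (intro bexI[OF _ w0]) simp
qed

theorem theorem4p2:
  fixes N :: nat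
  assumes "N \<ge> 2"
  shows "\<exists>L :: real \<Rightarrow> ennreal \<Rightarrow> real.
    \<forall>(\<rho> :: (real ^ 'd) measure) \<delta> :: real.
      \<rho> \<in> borel_subprobs \<and> mass \<rho> < 1 \<and> \<delta> > 0 \<and>
      scale_measure (ennreal (1 + \<delta>)) \<rho> \<in> borel_subprobs \<and>
      relaxed_cost N (scale_measure (ennreal (1 + \<delta>)) \<rho>) < \<infinity> \<longrightarrow>
      (\<exists>u\<in>admissible N.
         (L \<delta> (relaxed_cost N (scale_measure (ennreal (1 + \<delta>)) \<rho>)))-lipschitz_on UNIV u \<and>
         enn2ereal (relaxed_cost N \<rho>) = ereal (dual_value \<rho> u) \<and>
         ereal (dual_value \<rho> u) = dual_sup N \<rho>) \<and>
      (\<forall>v\<in>admissible N. ereal (dual_value \<rho> v) = dual_sup N \<rho> \<longrightarrow>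
         (\<exists>w\<in>admissible N. (\<exists>K. K-lipschitz_on UNIV w) \<and>
            ereal (dual_value \<rho> w) = dual_sup N \<rho> \<and>
            (\<forall>x\<in>msupport \<rho>. v x = w x)))"
proof -
  have "N \<ge> 1" using assms by simp
  note dual_attainment[OF this]
  then show ?thesis
    \<comment> \<open>The explicit constant of \<open>dual_attainment\<close>: N is fixed
      beforehand, so \<delta> and the relaxed cost remain as arguments.\<close>
    by (intro exI[of _ "\<lambda>\<delta> K. real N ^ 3 * ((real N - 1) * enn2real K / \<delta> + 1)\<^sup>2"]) blast
qed

end
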